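(* Let $t$ be a positive integer and $\mu$ a $t$-core partition. Then for every nonnegative integer $n$, $$\sum_{\substack{\lambda_{t\text{-core}}=\mu\\ |\lambda|-|\mu|=nt}}F_{\lambda/\mu}G_\lambda\sum_{\square\in\lambda}c_\square^2=t^2\binom n2+\frac{(t^3-t)n}{6}+2tn|\mu|+\sum_{\square\in\mu}c_\square^2.$$
   Context: Partitions are identified with Young diagrams (box $(i,j)$ in row $i$, column $j$; content $c_\square=j-i$); $\mathcal H(\lambda)$ is the multiset of hook lengths (for a box: boxes to its right in its row, plus below it, plus one). A $t$-core has no hook length divisible by $t$. The 01-sequence $(z_j)_{j\in\mathbb Z}$: traverse the boundary of the Young diagram from the bottom (infinite vertical ray below the first column) to the right (infinite horizontal ray right of the first row), labelling vertical edges $0$ and horizontal edges $1$, indexed so that $\#\{j\ge0:z_j=0\}=\#\{j<0:z_j=1\}$. Adding (resp. removing) a $t$-hook exchanges some $z_j=0,z_{j+t}=1$ into $1,0$ (resp. the reverse); $\lambda\ge_t\mu$ means $\lambda$ is obtained from $\mu$ by adding $t$-hooks; the $t$-core $\lambda_{t\text{-core}}$ is obtained by removing $t$-hooks until impossible. $F_{\lambda/\mu}$: $F_{\mu/\mu}=1$, $F_{\lambda/\mu}=\sum F_{\lambda^-/\mu}$ over $\lambda\ge_t\lambda^-\ge_t\mu$ with $|\lambda|-|\lambda^-|=t$. $G_\lambda=1/\prod_{h\in\mathcal H(\lambda),\,t\mid h}h$. *)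

theory Defs
  imports Complex_Main "HOL-Library.Multiset"
begin

text \<open>
  A partition is the list of its positive parts in weakly decreasing order. Rows and columns of its
  Young diagram are numbered from 0; this does not affect contents or hook lengths.
\<close>

definition is_partition :: "nat list \<Rightarrow> bool" where
  "is_partition p \<longleftrightarrow> sorted_wrt (\<ge>) p \<and> 0 \<notin> set p"

definition diagram :: "nat list \<Rightarrow> (nat \<times> nat) set" where
  "diagram p = {(i, j). i < length p \<and> j < p ! i}"

definition content :: "nat \<times> nat \<Rightarrow> int" where
  "content b = int (snd b) - int (fst b)"

definition hook_length :: "nat list \<Rightarrow> nat \<times> nat \<Rightarrow> nat" where
  "hook_length p b =
     card {j. j > snd b \<and> (fst b, j) \<in> diagram p} +
     card {i. i > fst b \<and> (i, snd b) \<in> diagram p} + 1"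

definition hook_lengths :: "nat list \<Rightarrow> nat multiset" where
  "hook_lengths p = image_mset (hook_length p) (mset_set (diagram p))"

definition t_core :: "nat \<Rightarrow> nat list \<Rightarrow> bool" where
  "t_core t p \<longleftrightarrow> is_partition p \<and> (\<forall>h \<in># hook_lengths p. \<not> t dvd h)"

text \<open>
  The lattice point \<open>(r, c)\<close> is the corner shared by the boxes \<open>(r - 1, c - 1)\<close> and \<open>(r, c)\<close>. A
  vertical edge from \<open>(r + 1, c)\<close> up to \<open>(r, c)\<close> separates the boxes \<open>(r, c - 1)\<close> and \<open>(r, c)\<close>; a
  horizontal edge from \<open>(r, c)\<close> right to \<open>(r, c + 1)\<close> separates the boxes \<open>(r - 1, c)\<close> and \<open>(r, c)\<close>.
  The cases \<open>c = 0\<close> and \<open>r = 0\<close> below account for the infinite rays (everything beyond the axes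
  counts as being on the side of the diagram).
\<close>

definition vertical_boundary_edge :: "nat list \<Rightarrow> nat \<Rightarrow> nat \<Rightarrow> bool" where
  "vertical_boundary_edge p r c \<longleftrightarrow>
     (r, c) \<notin> diagram p \<and> (c = 0 \<or> (r, c - 1) \<in> diagram p)"

definition horizontal_boundary_edge :: "nat list \<Rightarrow> nat \<Rightarrow> nat \<Rightarrow> bool" where
  "horizontal_boundary_edge p r c \<longleftrightarrow>
     (r, c) \<notin> diagram p \<and> (r = 0 \<or> (r - 1, c) \<in> diagram p)"

text \<open>
  \<open>boundary_labels p z\<close>: the sequence \<open>z\<close> labels the edges of the boundary of \<open>p\<close>, traversed through
  lattice points \<open>v k\<close> from the bottom to the right. Every step increases column minus row by one,
  so such a traversal indexed by all integers is unique up to a shift of the index and covers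
  the whole boundary.
\<close>

definition boundary_labels :: "nat list \<Rightarrow> (int \<Rightarrow> nat) \<Rightarrow> bool" where
  "boundary_labels p z \<longleftrightarrow>
     (\<exists>v :: int \<Rightarrow> nat \<times> nat. \<forall>k.
        (z k = 0 \<and> (\<exists>r c. v k = (r + 1, c) \<and> v (k + 1) = (r, c) \<and> vertical_boundary_edge p r c)) \<or>
        (z k = 1 \<and> (\<exists>r c. v k = (r, c) \<and> v (k + 1) = (r, c + 1) \<and> horizontal_boundary_edge p r c)))"

text \<open>The two sets counted below are finite for every labelling of a boundary.\<close>

definition zero_one_sequence :: "nat list \<Rightarrow> (int \<Rightarrow> nat) \<Rightarrow> bool" where
  "zero_one_sequence p z \<longleftrightarrow>
     boundary_labels p z \<and> card {j. j \<ge> 0 \<and> z j = 0} = card {j. j < 0 \<and> z j = 1}"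

text \<open>\<open>adds_hook t q p\<close>: the partition \<open>p\<close> arises from the partition \<open>q\<close> by adding one \<open>t\<close>-hook.\<close>

definition adds_hook :: "nat \<Rightarrow> nat list \<Rightarrow> nat list \<Rightarrow> bool" where
  "adds_hook t q p \<longleftrightarrow> is_partition q \<and> is_partition p \<and>
     (\<exists>z j. zero_one_sequence q z \<and> z j = 0 \<and> z (j + int t) = 1 \<and>
            zero_one_sequence p (z(j := 1, j + int t := 0)))"

definition hook_ge :: "nat \<Rightarrow> nat list \<Rightarrow> nat list \<Rightarrow> bool" where
  "hook_ge t p q \<longleftrightarrow> (adds_hook t)\<^sup>*\<^sup>* q p"

text \<open>
  \<open>is_t_core_of t q p\<close>: removing \<open>t\<close>-hooks from \<open>p\<close> until this is no longer possible yields \<open>q\<close>.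
\<close>

definition is_t_core_of :: "nat \<Rightarrow> nat list \<Rightarrow> nat list \<Rightarrow> bool" where
  "is_t_core_of t q p \<longleftrightarrow> hook_ge t p q \<and> \<not> (\<exists>q'. adds_hook t q' q)"

text \<open>
  The number \<open>F t p q\<close> is $F_{p/q}$. The recursion is only meaningful for \<open>t > 0\<close>;
  the value for \<open>t = 0\<close> is a dummy that ensures termination.
\<close>

function F :: "nat \<Rightarrow> nat list \<Rightarrow> nat list \<Rightarrow> nat" where
  "F t p q =
     (if p = q then 1
      else if t = 0 then 0
      else \<Sum>p' \<in> {p'. hook_ge t p p' \<and> hook_ge t p' q \<and> sum_list p = sum_list p' + t}. F t p' q)"
  by pat_completeness auto
termination
  by (relation "measure (\<lambda>(t, p, q). sum_list p)") auto

declare F.simps [simp del]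

definition G :: "nat \<Rightarrow> nat list \<Rightarrow> real" where
  "G t p = 1 / (\<Prod>h \<in># filter_mset (\<lambda>h. t dvd h) (hook_lengths p). real h)"

end

theory Submission
  imports "HOL-Computational_Algebra.Polynomial" Defs
begin

text \<open>
  Encode a partition by its beads, the positions of the zeros in its 01-sequence. Adding a
  \<open>t\<close>-hook moves a bead from \<open>x\<close> to \<open>x + t\<close>, and boxes correspond to pairs consisting of a
  bead and a smaller non-bead, the hook length being their difference. Hence \<open>G\<close> is a product over the
  residue classes modulo \<open>t\<close> (the runners), and the ratio $G_{\lambda^+}/G_\lambda$ is $1/t$ times the Kerov
  transition weight of the moved bead in its runner. Lagrange interpolation yields the moments of
  order 0, 1, 2 of these weights. Since the hook added at \<open>x\<close> has contents \<open>x + 1, \<dots>, x + t\<close>, they give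
  $\sum_{\lambda^+} G_{\lambda^+} = G_\lambda$, and show that the mean of $\sum c_\square^2$ with respect to
  the weights $F_{\lambda/\mu} G_\lambda$ increases from level \<open>n\<close> to level \<open>n + 1\<close> by
  $t (|\lambda| + |\mu|) + (t^3 - t)/6$ with $|\lambda| = |\mu| + nt$.
\<close>

section \<open>Partitions and beads\<close>

text \<open>The increment depends on the current partition only through its size, and this is what
  closes the induction on n: beyond total mass 1, nothing about the distribution of \<lambda> on a
  level is needed. On a runner with m beads and bead sum s, the second moment of the weights is
  linear in s; summed over the runners this yields |\<lambda>|. The part quadratic in m is, up to
  terms whose total over the runners is fixed, t times the bead sum of a runner whose m beads are
  packed to the bottom. That is the runner of the core, since a move by t never changes m, and so
  |\<mu>| enters.

  The obstacle is that bead sets are infinite below, while interpolation needs finitely many points.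
  Positions are therefore cut off at -K, with K so large that the lowest bead of each residue class
  cannot move. All terms in K cancel in the end.\<close>

definition row :: "nat list \<Rightarrow> nat \<Rightarrow> nat" where
  "row p i = (if i < length p then p ! i else 0)"

lemma row_antimono: "is_partition p \<Longrightarrow> i \<le> j \<Longrightarrow> row p j \<le> row p i"
  unfolding row_def is_partition_def
  by (cases "i = j") (auto simp: sorted_wrt_iff_nth_less)

lemma mem_diagram_iff [simp]: "(i, j) \<in> diagram p \<longleftrightarrow> j < row p i"
  by (auto simp: diagram_def row_def)

lemma row_eq_0: "length p \<le> i \<Longrightarrow> row p i = 0"
  by (simp add: row_def)

lemma row_pos: "is_partition p \<Longrightarrow> 0 < row p i \<longleftrightarrow> i < length p"
  by (auto simp: row_def is_partition_def) (metis nth_mem gr0I)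

lemma row_inj:
  assumes "is_partition p" "is_partition q" "row p = row q"
  shows "p = q"
proof -
  have "length p = length q"
    using row_pos[OF assms(1), of "length q"] row_pos[OF assms(2), of "length p"] assms(3)
      row_pos[OF assms(1), of "length p"] row_pos[OF assms(2), of "length q"]
    by (metis less_irrefl linorder_neqE_nat)
  then show ?thesis
    using assms(3) by (intro nth_equalityI) (auto simp: row_def fun_eq_iff split: if_splits)
qed

lemma partition_of_row:
  assumes anti: "\<And>i j. i \<le> j \<Longrightarrow> f j \<le> f i" and "f N = (0::nat)"
  obtains p where "is_partition p" "row p = f"
proof -
  define n where "n = (LEAST i. f i = 0)"
  have n0: "f n = 0" unfolding n_def using assms(2) by (rule LeastI)
  have lt: "f i \<noteq> 0" if "i < n" for i using that not_less_Least n_def by blast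
  have ge: "f i = 0" if "n \<le> i" for i using anti[OF that] n0 by simp
  show ?thesis
  proof
    show "is_partition (map f [0..<n])"
      using anti lt by (force simp: is_partition_def sorted_wrt_iff_nth_less)
    show "row (map f [0..<n]) = f"
      using ge by (auto simp: row_def fun_eq_iff)
  qed
qed

lemma sum_list_row: "length p \<le> K \<Longrightarrow> sum_list p = (\<Sum>i<K. row p i)"
proof -
  assume "length p \<le> K"
  then have "(\<Sum>i<K. row p i) = (\<Sum>i<length p. row p i)"
    by (intro sum.mono_neutral_right) (auto simp: row_def)
  then show ?thesis by (simp add: sum_list_sum_nth row_def atLeast0LessThan)
qed

lemma length_le_sum_list: "is_partition p \<Longrightarrow> length p \<le> sum_list p"
proof (induction p)
  case (Cons a p)
  then have "is_partition p" "a > 0" by (auto simp: is_partition_def)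
  then show ?case using Cons by auto
qed simp

lemma finite_partitions: "finite {p. is_partition p \<and> sum_list p = N}"
proof (rule finite_subset)
  show "{p. is_partition p \<and> sum_list p = N} \<subseteq> {p. set p \<subseteq> {..N} \<and> length p \<le> N}"
    using length_le_sum_list member_le_sum_list by fastforce
qed (rule finite_lists_length_le, simp)

text \<open>The Maya diagram of charge 0: the content of the last box of row \<open>i\<close>, or
  \<open>- i - 1\<close> if the row is empty. It is also the index of the vertical edge that ends
  the row.\<close>

definition bead :: "nat list \<Rightarrow> nat \<Rightarrow> int" where
  "bead p i = int (row p i) - int i - 1"

definition beads :: "nat list \<Rightarrow> int set" where
  "beads p = range (bead p)"

lemma bead_strict_antimono: "is_partition p \<Longrightarrow> i < j \<Longrightarrow> bead p j < bead p i"
  using row_antimono[of p i j] by (auto simp: bead_def)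

lemma bead_less_iff: "is_partition p \<Longrightarrow> bead p j < bead p i \<longleftrightarrow> i < j"
  using bead_strict_antimono[of p] by (metis less_asym' linorder_neqE_nat order_less_irrefl)

lemma inj_bead: "is_partition p \<Longrightarrow> inj (bead p)"
  using bead_strict_antimono[of p] by (metis injI less_irrefl linorder_neqE_nat)

lemma bead_ge: "is_partition p \<Longrightarrow> length p \<le> K \<Longrightarrow> bead p i \<ge> - int K \<longleftrightarrow> i < K"
  by (auto simp: bead_def row_def)

lemma low_beads: "length p \<le> K \<Longrightarrow> x < - int K \<Longrightarrow> x \<in> beads p"
  unfolding beads_def by (rule range_eqI[of _ _ "nat (- x - 1)"]) (auto simp: bead_def row_def)

definition col :: "nat list \<Rightarrow> nat \<Rightarrow> nat" where
  "col p j = (LEAST i. row p i \<le> j)"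

lemma less_col_iff:
  assumes "is_partition p" shows "i < col p j \<longleftrightarrow> j < row p i"
proof -
  have "row p (length p) \<le> j" by (simp add: row_def)
  then have "row p (col p j) \<le> j" unfolding col_def by (rule LeastI)
  then show ?thesis
    using row_antimono[OF assms, of "col p j" i] not_less_Least[of i "\<lambda>i. row p i \<le> j"]
    unfolding col_def[symmetric] by (meson leI le_trans not_le)
qed

lemma col_antimono: "is_partition p \<Longrightarrow> i \<le> j \<Longrightarrow> col p j \<le> col p i"
  using less_col_iff[of p "col p i" j] less_col_iff[of p "col p i" i] by (rule_tac ccontr) auto

text \<open>The index of the horizontal edge that closes column \<open>j\<close>. Hence
  \<open>bead p i - gap p j\<close> is arm plus leg plus one for a box
  \<open>(i, j)\<close>.\<close>

definition gap :: "nat list \<Rightarrow> nat \<Rightarrow> int" where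
  "gap p j = int j - int (col p j)"

lemma gap_strict_mono: "is_partition p \<Longrightarrow> i < j \<Longrightarrow> gap p i < gap p j"
  using col_antimono[of p i j] by (auto simp: gap_def)

lemma inj_gap: "is_partition p \<Longrightarrow> inj (gap p)"
  using gap_strict_mono[of p] by (metis injI less_irrefl linorder_neqE_nat)

lemma gap_less_bead: "is_partition p \<Longrightarrow> j < row p i \<Longrightarrow> gap p j < bead p i"
  using less_col_iff[of p i j] by (auto simp: bead_def gap_def)

lemma bead_less_gap: "is_partition p \<Longrightarrow> row p i \<le> j \<Longrightarrow> bead p i < gap p j"
  using less_col_iff[of p i j] by (auto simp: bead_def gap_def)

lemma gap_less_bead_iff: "is_partition p \<Longrightarrow> gap p j < bead p i \<longleftrightarrow> j < row p i"
  using gap_less_bead bead_less_gap by (meson leI less_asym')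

lemma gap_notin_beads: "is_partition p \<Longrightarrow> gap p j \<notin> beads p"
  using gap_less_bead bead_less_gap unfolding beads_def by (metis imageE leI less_irrefl)

text \<open>The boundary meets each diagonal in one point; it is in row \<open>level p k\<close> on diagonal \<open>k\<close>.\<close>

definition level :: "nat list \<Rightarrow> int \<Rightarrow> nat" where
  "level p k = (LEAST i. bead p i < k)"

text \<open>Beads decrease strictly, so \<open>level p k\<close> is the number of beads at or above
  \<open>k\<close>.\<close>

lemma less_level_iff:
  assumes "is_partition p" shows "i < level p k \<longleftrightarrow> k \<le> bead p i"
proof -
  have "bead p (nat (- k) + length p) < k" by (simp add: bead_def row_def)
  then have "bead p (level p k) < k" unfolding level_def by (rule LeastI)
  then show ?thesis
    using bead_strict_antimono[OF assms, of "level p k" i] not_less_Least[of i "\<lambda>i. bead p i < k"]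
    unfolding level_def[symmetric] by (metis leD leI le_less_linear less_trans nat_neq_iff)
qed

lemma row_level:
  assumes "is_partition p" shows "int (row p (level p k)) \<le> k + int (level p k)"
  using less_level_iff[OF assms, of "level p k" k] by (auto simp: bead_def)

lemma level_bead: "is_partition p \<Longrightarrow> level p (bead p i) = Suc i"
  by (rule antisym) (metis bead_less_iff less_level_iff less_Suc_eq_le not_le lessI,
      metis Suc_leI less_level_iff order_refl)

lemma level_bead_Suc: "is_partition p \<Longrightarrow> level p (bead p i + 1) = i"
  using less_level_iff[of p i "bead p i + 1"] less_level_iff[of p "level p (bead p i + 1)" "bead p i + 1"]
    bead_strict_antimono[of p "level p (bead p i + 1)" i]
  by (cases i "level p (bead p i + 1)" rule: linorder_cases) auto

lemma level_nonbead:
  assumes "is_partition p" "k \<notin> beads p" shows "level p (k + 1) = level p k"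
proof -
  have "i < level p (k + 1) \<longleftrightarrow> i < level p k" for i
    using assms unfolding less_level_iff[OF assms(1)] beads_def
    by (metis add1_zle_eq order_le_less rangeI)
  then show ?thesis by (meson linorder_neqE_nat less_irrefl)
qed

text \<open>The boundary meets diagonal \<open>k\<close> in row \<open>level p k\<close> and column
  \<open>k + level p k\<close>. If \<open>k\<close> is not a bead, the step leaving this point must
  be horizontal: the first two claims are its boundary conditions, the third identifies the column
  that it closes.\<close>

lemma nonbead_gap:
  assumes p: "is_partition p" and k: "k \<notin> beads p"
  shows "row p (level p k) \<le> nat (k + int (level p k))"
    "level p k = 0 \<or> nat (k + int (level p k)) < row p (level p k - 1)"
    "k = gap p (nat (k + int (level p k)))"
proof -
  let ?r = "level p k" and ?c = "nat (k + int (level p k))"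
  have nn: "0 \<le> k + int ?r" using row_level[OF p, of k] by linarith
  show 1: "row p ?r \<le> ?c" using row_level[OF p, of k] by linarith
  show 2: "?r = 0 \<or> ?c < row p (?r - 1)"
  proof (cases ?r)
    case (Suc r)
    then have "k \<le> bead p r" using less_level_iff[OF p, of r k] by simp
    moreover have "k \<noteq> bead p r" using k by (auto simp: beads_def)
    ultimately show ?thesis using Suc nn by (simp add: bead_def nat_less_iff)
  qed simp
  have "col p ?c = ?r"
  proof (rule antisym)
    show "col p ?c \<le> ?r" using 1 less_col_iff[OF p, of ?r ?c] by linarith
    show "?r \<le> col p ?c" using 2 less_col_iff[OF p, of "?r - 1" ?c] by linarith
  qed
  then show "k = gap p ?c" using nn by (simp add: gap_def)
qed

lemma range_gap:
  assumes "is_partition p" shows "range (gap p) = - beads p"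
proof
  show "range (gap p) \<subseteq> - beads p" using gap_notin_beads[OF assms] by blast
  show "- beads p \<subseteq> range (gap p)" using nonbead_gap(3)[OF assms] by blast
qed

section \<open>The 01-sequence in terms of beads\<close>

lemma vertical_boundary_edge_iff: "vertical_boundary_edge p r c \<longleftrightarrow> c = row p r"
  by (auto simp: vertical_boundary_edge_def)

lemma horizontal_boundary_edge_iff:
  "horizontal_boundary_edge p r c \<longleftrightarrow> row p r \<le> c \<and> (r = 0 \<or> c < row p (r - 1))"
  by (auto simp: horizontal_boundary_edge_def)

lemma horizontal_nonbead:
  assumes p: "is_partition p" and h: "horizontal_boundary_edge p r c"
  shows "int c - int r \<notin> beads p"
proof -
  have "col p c = r"
  proof (rule antisym)
    show "col p c \<le> r" using h less_col_iff[OF p, of r c] by (auto simp: horizontal_boundary_edge_iff)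
    show "r \<le> col p c" using h less_col_iff[OF p, of "r - 1" c] by (auto simp: horizontal_boundary_edge_iff)
  qed
  then show ?thesis using gap_notin_beads[OF p, of c] by (simp add: gap_def)
qed

lemma boundary_labels_beads:
  assumes p: "is_partition p"
  shows "boundary_labels p (\<lambda>k. if k \<in> beads p then 0 else 1)"
  unfolding boundary_labels_def
proof (intro exI allI)
  fix k
  let ?v = "\<lambda>k. (level p k, nat (k + int (level p k)))"
  show "((if k \<in> beads p then 0 else 1 :: nat) = 0 \<and>
          (\<exists>r c. ?v k = (r + 1, c) \<and> ?v (k + 1) = (r, c) \<and> vertical_boundary_edge p r c)) \<or>
        ((if k \<in> beads p then 0 else 1 :: nat) = 1 \<and>
          (\<exists>r c. ?v k = (r, c) \<and> ?v (k + 1) = (r, c + 1) \<and> horizontal_boundary_edge p r c))"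
  proof (cases "k \<in> beads p")
    case True
    then obtain i where i: "k = bead p i" by (auto simp: beads_def)
    then have "level p k = Suc i" "level p (k + 1) = i" "k + int i + 1 = int (row p i)"
      using p by (simp_all add: level_bead level_bead_Suc, simp add: bead_def)
    then show ?thesis
      using True by (simp add: vertical_boundary_edge_iff algebra_simps)
  next
    case False
    have "0 \<le> k + int (level p k)" using row_level[OF p, of k] by linarith
    then have "nat (k + 1 + int (level p k)) = nat (k + int (level p k)) + 1" by simp
    then show ?thesis using False nonbead_gap(1,2)[OF p False]
      by (simp add: level_nonbead[OF p False] horizontal_boundary_edge_iff)
  qed
qed

text \<open>Every step raises column minus row by one, so a traversal is fixed up to the diagonal
  \<open>d 0\<close> that it visits at index 0. Vertical edges occur only on diagonals of beads,
  horizontal ones only on those of non-beads.\<close>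

lemma boundary_labels_shift:
  assumes p: "is_partition p" and z: "boundary_labels p z"
  obtains s where "\<And>k. z k = (if k + s \<in> beads p then 0 else 1)"
proof -
  obtain v where v: "\<And>k.
        (z k = 0 \<and> (\<exists>r c. v k = (r + 1, c) \<and> v (k + 1) = (r, c) \<and> vertical_boundary_edge p r c)) \<or>
        (z k = 1 \<and> (\<exists>r c. v k = (r, c) \<and> v (k + 1) = (r, c + 1) \<and> horizontal_boundary_edge p r c))"
    using z unfolding boundary_labels_def by blast
  define d where "d k = int (snd (v k)) - int (fst (v k))" for k
  have step: "d (k + 1) = d k + 1" for k
    using v[of k] by (auto simp: d_def)
  have d: "d k = k + d 0" for k
  proof (induction k rule: int_induct[where k = 0])
    case (step1 i) then show ?case using step[of i] by simp
  next
    case (step2 i) then show ?case using step[of "i - 1"] by simp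
  qed simp
  show ?thesis
  proof
    fix k
    consider r c where "z k = 0" "v k = (r + 1, c)" "vertical_boundary_edge p r c"
      | r c where "z k = 1" "v k = (r, c)" "horizontal_boundary_edge p r c"
      using v[of k] by blast
    then show "z k = (if k + d 0 \<in> beads p then 0 else 1)"
    proof cases
      case 1
      then have "d k = bead p r" by (simp add: d_def vertical_boundary_edge_iff bead_def)
      then show ?thesis using 1 d[of k] by (simp add: beads_def)
    next
      case 2
      then have "d k \<notin> beads p" using horizontal_nonbead[OF p] by (simp add: d_def)
      then show ?thesis using 2 d[of k] by simp
    qed
  qed
qed

section \<open>Counting beads and non-beads around a cut\<close>

lemma beads_above:
  assumes "is_partition p" "length p \<le> K"
  shows "{x \<in> beads p. x \<ge> - int K} = bead p ` {..<K}"
  using bead_ge[OF assms] by (auto simp: beads_def)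

lemma card_beads_above:
  assumes "is_partition p" "length p \<le> K"
  shows "card {x \<in> beads p. x \<ge> - int K} = K"
  by (simp add: beads_above[OF assms] card_image inj_on_subset[OF inj_bead[OF assms(1)]])

lemma finite_beads_ge:
  assumes "is_partition p" shows "finite {x \<in> beads p. x \<ge> a}"
proof (rule finite_subset)
  let ?K = "length p + nat \<bar>a\<bar>"
  show "{x \<in> beads p. x \<ge> a} \<subseteq> {x \<in> beads p. x \<ge> - int ?K}" by auto
  show "finite {x \<in> beads p. x \<ge> - int ?K}" by (subst beads_above[OF assms]) auto
qed

lemma finite_gaps_less:
  "finite {x. x \<notin> beads p \<and> x < a}"
proof (rule finite_subset)
  show "{x. x \<notin> beads p \<and> x < a} \<subseteq> {- int (length p)..<a}"
    using low_beads[of p "length p"] by (auto simp: not_less[symmetric])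
qed simp

text \<open>Raising the cut by one either drops a bead from the first count or adds a non-bead to
  the second; both lower the difference by one. No non-bead lies below \<open>- length p\<close>,
  which gives the base value. Consequently the balance condition of the 01-sequence admits only the
  shift 0.\<close>

lemma charge:
  assumes p: "is_partition p"
  shows "int (card {x \<in> beads p. x \<ge> s}) - int (card {x. x \<notin> beads p \<and> x < s}) = - s"
proof -
  define f where "f s = int (card {x \<in> beads p. x \<ge> s}) - int (card {x. x \<notin> beads p \<and> x < s})" for s
  have step: "f (s + 1) = f s - 1" for s
  proof -
    have le: "s \<le> x \<longleftrightarrow> x = s \<or> s + 1 \<le> x" for x by auto
    show ?thesis
    proof (cases "s \<in> beads p")
      case True
      then have "{x \<in> beads p. x \<ge> s} = insert s {x \<in> beads p. x \<ge> s + 1}"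
        and "{x. x \<notin> beads p \<and> x < s + 1} = {x. x \<notin> beads p \<and> x < s}"
        by (auto simp: le order_le_less)
      then show ?thesis using finite_beads_ge[OF p] by (simp add: f_def)
    next
      case False
      then have "{x \<in> beads p. x \<ge> s} = {x \<in> beads p. x \<ge> s + 1}"
        and "{x. x \<notin> beads p \<and> x < s + 1} = insert s {x. x \<notin> beads p \<and> x < s}"
        by (auto simp: le order_le_less)
      then show ?thesis using finite_gaps_less[of p s] by (simp add: f_def)
    qed
  qed
  have "f s = - s"
  proof (induction s rule: int_induct[where k = "- int (length p)"])
    case base
    have "{x. x \<notin> beads p \<and> x < - int (length p)} = {}" using low_beads by blast
    then show ?case using card_beads_above[OF p, of "length p"] by (simp only: f_def card.empty)
  next
    case (step1 s) then show ?case using step[of s] by simp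
  next
    case (step2 s) then show ?case using step[of "s - 1"] by simp
  qed
  then show ?thesis by (simp add: f_def)
qed

lemma zero_one_sequence_iff:
  assumes p: "is_partition p"
  shows "zero_one_sequence p z \<longleftrightarrow> z = (\<lambda>k. if k \<in> beads p then 0 else 1)"
proof -
  have shift: "{j. P (j + s)} = (\<lambda>x. x - s) ` {x. P x}" for P :: "int \<Rightarrow> bool" and s
  proof (intro equalityI subsetI)
    fix j assume "j \<in> {j. P (j + s)}"
    then show "j \<in> (\<lambda>x. x - s) ` {x. P x}" by (intro image_eqI[of _ _ "j + s"]) auto
  qed auto
  have if0: "(if Q then 0 else 1 :: nat) = 0 \<longleftrightarrow> Q"
    and if1: "(if Q then 0 else 1 :: nat) = 1 \<longleftrightarrow> \<not> Q" for Q by auto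
  have eq: "{j. j \<ge> 0 \<and> (if j + s \<in> beads p then 0 else 1 :: nat) = 0} = (\<lambda>x. x - s) ` {x \<in> beads p. x \<ge> s}"
    "{j. j < 0 \<and> (if j + s \<in> beads p then 0 else 1 :: nat) = 1} = (\<lambda>x. x - s) ` {x. x \<notin> beads p \<and> x < s}"
    for s
    using shift[of "\<lambda>x. x \<in> beads p \<and> x \<ge> s" s] shift[of "\<lambda>x. x \<notin> beads p \<and> x < s" s]
    by (simp_all only: if0 if1) (simp_all add: conj_commute)
  have card: "card {j. j \<ge> 0 \<and> (if j + s \<in> beads p then 0 else 1 :: nat) = 0} =
      card {j. j < 0 \<and> (if j + s \<in> beads p then 0 else 1 :: nat) = 1} \<longleftrightarrow> s = 0" for s
    unfolding eq using charge[OF p, of s] by (simp add: card_image inj_on_def) linarith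
  show ?thesis
  proof
    assume z: "zero_one_sequence p z"
    then obtain s where s: "\<And>k. z k = (if k + s \<in> beads p then 0 else 1)"
      using boundary_labels_shift[OF p] unfolding zero_one_sequence_def by blast
    then have "z = (\<lambda>k. if k + s \<in> beads p then 0 else 1)" by blast
    moreover from this have "s = 0" using z card[of s] unfolding zero_one_sequence_def by blast
    ultimately show "z = (\<lambda>k. if k \<in> beads p then 0 else 1)" by simp
  next
    assume "z = (\<lambda>k. if k \<in> beads p then 0 else 1)"
    then show "zero_one_sequence p z"
      using boundary_labels_beads[OF p] card[of 0] unfolding zero_one_sequence_def by simp
  qed
qed

section \<open>Partitions as bead sets of charge 0\<close>

lemma adds_hook_iff:
  assumes "t > 0"
  shows "adds_hook t q p \<longleftrightarrow> is_partition q \<and> is_partition p \<and>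
    (\<exists>x. x \<in> beads q \<and> x + int t \<notin> beads q \<and> beads p = insert (x + int t) (beads q - {x}))"
proof (cases "is_partition q \<and> is_partition p")
  case True
  have ind: "(\<lambda>k. if k \<in> A then 0 else 1 :: nat) = (\<lambda>k. if k \<in> B then 0 else 1) \<longleftrightarrow> A = B"
    for A B :: "int set"
    by (auto simp: fun_eq_iff)
  have "(\<lambda>k. if k \<in> beads q then 0 else 1 :: nat)(x := 1, x + int t := 0) =
      (\<lambda>k. if k \<in> insert (x + int t) (beads q - {x}) then 0 else 1)" for x
    using assms by (intro ext) auto
  then have upd: "(\<lambda>k. if k \<in> beads q then 0 else 1 :: nat)(x := 1, x + int t := 0) =
      (\<lambda>k. if k \<in> beads p then 0 else 1) \<longleftrightarrow> beads p = insert (x + int t) (beads q - {x})" for x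
    using ind[of _ "beads p"] by metis
  have if0: "(if Q then 0 else 1 :: nat) = 0 \<longleftrightarrow> Q"
    and if1: "(if Q then 0 else 1 :: nat) = 1 \<longleftrightarrow> \<not> Q" for Q by auto
  show ?thesis using True
    by (simp only: adds_hook_def zero_one_sequence_iff upd if0 if1 simp_thms ex_simps)
qed (auto simp: adds_hook_def)

text \<open>The beads are recovered from the counts: \<open>bead p i\<close> is the largest
  \<open>k\<close> with \<open>i < level p k\<close>.\<close>

lemma beads_inj:
  assumes p: "is_partition p" and q: "is_partition q" and eq: "beads p = beads q"
  shows "p = q"
proof -
  have *: "{x \<in> beads r. x \<ge> k} = bead r ` {..<level r k}" if "is_partition r" for r k
    using less_level_iff[OF that] by (auto simp: beads_def)
  have "card {x \<in> beads r. x \<ge> k} = level r k" if "is_partition r" for r k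
    unfolding *[OF that] by (simp add: card_image inj_on_subset[OF inj_bead[OF that]])
  then have "level p = level q" using p q eq by (metis ext)
  then have "k \<le> bead p i \<longleftrightarrow> k \<le> bead q i" for k i
    using less_level_iff p q by metis
  then have "bead p i = bead q i" for i by (meson order.antisym order_refl)
  then have "row p = row q" by (auto simp: bead_def fun_eq_iff)
  then show ?thesis using row_inj p q by blast
qed

text \<open>The cardinality hypothesis expresses charge 0. When \<open>T\<close> is listed downwards
  as \<open>e\<close>, the numbers \<open>e i + i + 1\<close> are the row lengths, and they vanish
  from index \<open>N\<close> on.\<close>

lemma partition_of_beads:
  assumes low: "\<And>x. x < - int N \<Longrightarrow> x \<in> T"
    and fin: "finite {x \<in> T. x \<ge> - int N}" and card: "card {x \<in> T. x \<ge> - int N} = N"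
  obtains p where "is_partition p" "beads p = T"
proof -
  define xs where "xs = rev (sorted_list_of_set {x \<in> T. x \<ge> - int N})"
  have len: "length xs = N" using card by (simp add: xs_def)
  have set: "set xs = {x \<in> T. x \<ge> - int N}" using fin by (simp add: xs_def)
  have "sorted_wrt (>) xs" by (simp add: xs_def sorted_wrt_rev)
  then have dec: "xs ! j < xs ! i" if "i < j" "j < N" for i j
    using that len by (simp add: sorted_wrt_iff_nth_less)
  define e where "e i = (if i < N then xs ! i else - int i - 1)" for i
  have e1: "e (Suc i) < e i" for i
    using dec[of i "Suc i"] nth_mem[of i xs] len set by (auto simp: e_def)
  have ee: "e (i + d) + int d \<le> e i" for i d
  proof (induction d)
    case (Suc d) then show ?case using e1[of "i + d"] by simp
  qed simp
  \<comment> \<open>At index \<open>i + N\<close> the sequence has its ground value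
    \<open>- i - N - 1\<close>; strict decrease over \<open>N\<close> steps then bounds
    \<open>e i\<close> from below by \<open>- i - 1\<close>.\<close>
  have nonneg: "e i + int i + 1 \<ge> 0" for i
    using ee[of i N] by (simp add: e_def)
  have anti: "nat (e j + int j + 1) \<le> nat (e i + int i + 1)" if "i \<le> j" for i j
    using ee[of i "j - i"] that by simp
  have "nat (e N + int N + 1) = 0" by (simp add: e_def)
  from partition_of_row[where f = "\<lambda>i. nat (e i + int i + 1)", OF anti this]
  obtain p where p: "is_partition p" "row p = (\<lambda>i. nat (e i + int i + 1))" by blast
  have "bead p = e" using nonneg by (auto simp: bead_def p(2) fun_eq_iff)
  moreover have "range e = T"
  proof (intro equalityI subsetI)
    fix x assume "x \<in> range e"
    then obtain i where i: "x = e i" by blast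
    show "x \<in> T"
    proof (cases "i < N")
      case True then show ?thesis using i nth_mem[of i xs] len set by (simp add: e_def)
    next
      case False then show ?thesis using i low by (simp add: e_def)
    qed
  next
    fix x assume "x \<in> T"
    show "x \<in> range e"
    proof (cases "x \<ge> - int N")
      case True
      then have "x \<in> set xs" using \<open>x \<in> T\<close> set by simp
      then obtain i where "i < N" "xs ! i = x" using len by (metis in_set_conv_nth)
      then show ?thesis by (metis e_def rangeI)
    next
      case False
      then show ?thesis by (intro range_eqI[of _ _ "nat (- x - 1)"]) (auto simp: e_def)
    qed
  qed
  ultimately show ?thesis using that p(1) by (simp add: beads_def)
qed

lemma partition_move_bead:
  assumes q: "is_partition q" and x: "x \<in> beads q" "x + int t \<notin> beads q"
  obtains p where "is_partition p" "beads p = insert (x + int t) (beads q - {x})"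
proof -
  \<comment> \<open>The non-bead \<open>x + t\<close> is at least \<open>- length q\<close>, so
    \<open>x\<close> is at least \<open>- N\<close>: the move takes place above the cut and
    preserves the count there.\<close>
  define N where "N = length q + t"
  let ?T = "insert (x + int t) (beads q - {x})"
  have xN: "x \<ge> - int N" using x(2) low_beads[of q "length q" "x + int t"] by (force simp: N_def)
  have eq: "{y \<in> ?T. y \<ge> - int N} = insert (x + int t) ({y \<in> beads q. y \<ge> - int N} - {x})"
    using xN by auto
  have fin: "finite {y \<in> beads q. y \<ge> - int N}" by (rule finite_beads_ge[OF q])
  have c: "card {y \<in> beads q. y \<ge> - int N} = N" using q by (intro card_beads_above) (auto simp: N_def)
  have mem: "x \<in> {y \<in> beads q. y \<ge> - int N}" using x xN by simp
  have "card {y \<in> beads q. y \<ge> - int N} > 0" using fin mem card_gt_0_iff by blast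
  then have N: "N > 0" by (simp only: c)
  have "card {y \<in> ?T. y \<ge> - int N} = N"
    unfolding eq using fin x(2) card_Diff_singleton[OF mem] N c by simp
  moreover have "finite {y \<in> ?T. y \<ge> - int N}" unfolding eq using fin by simp
  moreover have "y \<in> ?T" if "y < - int N" for y
    using low_beads[of q N y] xN that by (auto simp: N_def)
  ultimately show ?thesis using partition_of_beads[of N ?T] that by blast
qed

section \<open>Hooks as pairs of a non-bead and a bead\<close>

definition hook_pairs :: "nat \<Rightarrow> nat list \<Rightarrow> (int \<times> int) set" where
  "hook_pairs t p = {(a, b). a \<notin> beads p \<and> b \<in> beads p \<and> a < b \<and> int t dvd b - a}"

lemma diagram_Sigma: "diagram p = (SIGMA i:{..<length p}. {..<row p i})"
  by (auto simp: diagram_def row_def)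

lemma finite_diagram: "finite (diagram p)"
  by (simp add: diagram_Sigma)

lemma hook_length_beads:
  assumes p: "is_partition p" and j: "j < row p i"
  shows "hook_length p (i, j) = nat (bead p i - gap p j)"
proof -
  have "{j'. j' > j \<and> (i, j') \<in> diagram p} = {j<..<row p i}" by auto
  moreover have "{i'. i' > i \<and> (i', j) \<in> diagram p} = {i<..<col p j}"
    using less_col_iff[OF p] by auto
  moreover have "i < col p j" using less_col_iff[OF p] j by simp
  ultimately show ?thesis using j by (simp add: hook_length_def bead_def gap_def nat_eq_iff)
qed

lemma hook_pairs_bij:
  assumes p: "is_partition p"
  shows "bij_betw (\<lambda>(i, j). (gap p j, bead p i)) {b \<in> diagram p. t dvd hook_length p b} (hook_pairs t p)"
  unfolding bij_betw_def
proof
  show "inj_on (\<lambda>(i, j). (gap p j, bead p i)) {b \<in> diagram p. t dvd hook_length p b}"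
    using inj_gap[OF p] inj_bead[OF p] by (auto simp: inj_on_def)
  have dvd: "t dvd hook_length p (i, j) \<longleftrightarrow> int t dvd bead p i - gap p j" if "j < row p i" for i j
    using gap_less_bead[OF p that]
    by (simp add: hook_length_beads[OF p that] int_dvd_int_iff[symmetric] del: int_dvd_int_iff)
  have gn: "gap p j \<noteq> bead p i" for i j
    using gap_notin_beads[OF p, of j] by (metis beads_def rangeI)
  show "(\<lambda>(i, j). (gap p j, bead p i)) ` {b \<in> diagram p. t dvd hook_length p b} = hook_pairs t p"
  proof (intro equalityI subsetI)
    fix x assume "x \<in> (\<lambda>(i, j). (gap p j, bead p i)) ` {b \<in> diagram p. t dvd hook_length p b}"
    then show "x \<in> hook_pairs t p"
      using dvd gap_less_bead[OF p] gn by (auto simp: hook_pairs_def beads_def)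
  next
    fix x assume "x \<in> hook_pairs t p"
    then obtain a b where x: "x = (a, b)" "a \<notin> beads p" "b \<in> beads p" "a < b" "int t dvd b - a"
      by (auto simp: hook_pairs_def)
    obtain i where i: "b = bead p i" using x(3) by (auto simp: beads_def)
    obtain j where j: "a = gap p j" using x(2) range_gap[OF p] by blast
    have "j < row p i" using x(4) gap_less_bead_iff[OF p] i j by simp
    then show "x \<in> (\<lambda>(i, j). (gap p j, bead p i)) ` {b \<in> diagram p. t dvd hook_length p b}"
      using x i j dvd by (intro image_eqI[of _ _ "(i, j)"]) auto
  qed
qed

lemma finite_hook_pairs: "is_partition p \<Longrightarrow> finite (hook_pairs t p)"
  using bij_betw_finite[OF hook_pairs_bij[of p t]] finite_diagram by simp

lemma G_hook_pairs:
  assumes p: "is_partition p"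
  shows "G t p = 1 / (\<Prod>(a, b) \<in> hook_pairs t p. real_of_int (b - a))"
proof -
  have "(\<Prod>h \<in># filter_mset (\<lambda>h. t dvd h) (hook_lengths p). real h) =
      (\<Prod>b | b \<in> diagram p \<and> t dvd hook_length p b. real (hook_length p b))"
    by (simp add: hook_lengths_def filter_mset_image_mset image_mset.compositionality o_def
        finite_diagram prod_unfold_prod_mset)
  also have "\<dots> = (\<Prod>b \<in> {b \<in> diagram p. t dvd hook_length p b}.
      (\<lambda>(a, b). real_of_int (b - a)) (case b of (i, j) \<Rightarrow> (gap p j, bead p i)))"
    using hook_length_beads[OF p] gap_less_bead[OF p]
    by (intro prod.cong) (auto simp: less_imp_le)
  also have "\<dots> = (\<Prod>(a, b) \<in> hook_pairs t p. real_of_int (b - a))"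
    by (rule prod.reindex_bij_betw[OF hook_pairs_bij[OF p]])
  finally show ?thesis by (simp add: G_def)
qed

lemma t_core_iff:
  assumes "is_partition p" shows "t_core t p \<longleftrightarrow> hook_pairs t p = {}"
proof -
  have "t_core t p \<longleftrightarrow> {b \<in> diagram p. t dvd hook_length p b} = {}"
    using assms finite_diagram[of p] by (auto simp: t_core_def hook_lengths_def)
  also have "\<dots> \<longleftrightarrow> hook_pairs t p = {}"
    by (subst bij_betw_imp_surj_on[OF hook_pairs_bij[OF assms, of t], symmetric]) (rule image_is_empty[symmetric])
  finally show ?thesis .
qed

text \<open>The finite stand-in for the bead set. For \<open>K\<close> at least
  \<open>length p\<close> it consists of the first \<open>K\<close> beads.\<close>

definition window :: "nat \<Rightarrow> nat list \<Rightarrow> int set" where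
  "window K p = {x \<in> beads p. x \<ge> - int K}"

lemma finite_window: "is_partition p \<Longrightarrow> finite (window K p)"
  by (simp add: window_def finite_beads_ge)

lemma sum_window:
  assumes "is_partition p" "length p \<le> K"
  shows "(\<Sum>x \<in> window K p. f x) = (\<Sum>i<K. f (bead p i))"
  unfolding window_def beads_above[OF assms]
  by (simp add: sum.reindex inj_on_subset[OF inj_bead[OF assms(1)]])

text \<open>The contents of row \<open>i\<close> run from \<open>- i\<close> to
  \<open>bead p i\<close>. Extending them down to \<open>- K\<close> makes the row sum a function of
  the bead alone, and the correction is the same for all partitions.\<close>

lemma sum_contents_window:
  fixes f :: "int \<Rightarrow> 'a :: ab_group_add"
  assumes p: "is_partition p" "length p \<le> K"
  shows "(\<Sum>b \<in> diagram p. f (content b)) =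
    (\<Sum>x \<in> window K p. \<Sum>c = - int K..x. f c) - (\<Sum>i<K. \<Sum>c = - int K..<- int i. f c)"
proof -
  have row: "(\<Sum>j<row p i. f (int j - int i)) = (\<Sum>c = - int K..bead p i. f c) - (\<Sum>c = - int K..<- int i. f c)"
    if "i < K" for i
  proof -
    have "{- int K..bead p i} = {- int K..<- int i} \<union> {- int i..bead p i}"
      using that by (auto simp: bead_def)
    then have "(\<Sum>c = - int K..bead p i. f c) = (\<Sum>c = - int K..<- int i. f c) + (\<Sum>c = - int i..bead p i. f c)"
      by (simp add: sum.union_disjoint[symmetric] ivl_disj_int)
    moreover have "(\<Sum>j<row p i. f (int j - int i)) = (\<Sum>c = - int i..bead p i. f c)"
      by (rule sum.reindex_bij_witness[where i = "\<lambda>c. nat (c + int i)" and j = "\<lambda>j. int j - int i"])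
        (auto simp: bead_def)
    ultimately show ?thesis by simp
  qed
  have "diagram p = (SIGMA i:{..<K}. {..<row p i})"
    using p(2) row_eq_0[of p] by (auto simp: not_less dest: leD intro: ccontr)
  then have "(\<Sum>b \<in> diagram p. f (content b)) = (\<Sum>i<K. \<Sum>j<row p i. f (int j - int i))"
    by (simp add: sum.Sigma content_def case_prod_unfold)
  also have "\<dots> = (\<Sum>i<K. (\<Sum>c = - int K..bead p i. f c) - (\<Sum>c = - int K..<- int i. f c))"
    by (intro sum.cong) (auto simp: row)
  finally show ?thesis by (simp add: sum_subtractf sum_window[OF p])
qed

lemma sum_list_window:
  assumes "is_partition p" "length p \<le> K"
  shows "real (sum_list p) = (\<Sum>x \<in> window K p. real_of_int x) + real K * (real K + 1) / 2"
proof -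
  have "(\<Sum>x \<in> window K p. real_of_int x) = (\<Sum>i<K. real (row p i) - (real i + 1))"
    unfolding sum_window[OF assms] by (simp add: bead_def algebra_simps)
  moreover have "(\<Sum>i<k. real i + 1) = real k * (real k + 1) / 2" for k
    by (induction k) (auto simp: field_simps)
  ultimately show ?thesis using sum_list_row[OF assms(2)] by (simp add: sum_subtractf)
qed

lemma card_diagram: "card (diagram p) = sum_list p"
  by (simp add: diagram_Sigma sum_list_row[OF order_refl])

section \<open>Effect of moving one bead on contents, size and hooks\<close>

locale hook_move =
  fixes t :: nat and q p :: "nat list" and x :: int
  assumes t: "t > 0" and q: "is_partition q" and p: "is_partition p"
    and x: "x \<in> beads q" "x + int t \<notin> beads q"
    and beads_p: "beads p = insert (x + int t) (beads q - {x})"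
begin

lemma bead_ge_window: "length q + t \<le> K \<Longrightarrow> x \<ge> - int K"
  using x(2) low_beads[of q "length q" "x + int t"] by force

lemma window_move:
  assumes "length q + t \<le> K"
  shows "window K p = insert (x + int t) (window K q - {x})"
  using bead_ge_window[OF assms] by (auto simp: window_def beads_p)

lemma sum_window_move:
  fixes f :: "int \<Rightarrow> 'a :: ab_group_add"
  assumes "length q + t \<le> K"
  shows "(\<Sum>y \<in> window K p. f y) = (\<Sum>y \<in> window K q. f y) - f x + f (x + int t)"
proof -
  have "x \<in> window K q" using x bead_ge_window[OF assms] by (simp add: window_def)
  moreover have "x + int t \<notin> window K q" using x by (simp add: window_def)
  ultimately show ?thesis
    by (simp add: window_move[OF assms] finite_window q sum_diff1 add.commute)
qed

text \<open>The corrections for \<open>p\<close> and \<open>q\<close> cancel, and the interval of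
  the moved bead grows by the contents of the added hook. With a constant \<open>f\<close> this also
  gives the change of size.\<close>

lemma sum_contents_move:
  fixes f :: "int \<Rightarrow> 'a :: ab_group_add"
  shows "(\<Sum>b \<in> diagram p. f (content b)) =
    (\<Sum>b \<in> diagram q. f (content b)) + (\<Sum>c = x + 1..x + int t. f c)"
proof -
  define K where "K = length p + length q + t"
  have K: "length p \<le> K" "length q \<le> K" "length q + t \<le> K" by (auto simp: K_def)
  have "{- int K..x + int t} = {- int K..x} \<union> {x + 1..x + int t}"
    using bead_ge_window[OF K(3)] by auto
  then have "(\<Sum>c = - int K..x + int t. f c) = (\<Sum>c = - int K..x. f c) + (\<Sum>c = x + 1..x + int t. f c)"
    by (simp add: sum.union_disjoint[symmetric])
  then show ?thesis
    by (simp add: sum_contents_window[OF p K(1)] sum_contents_window[OF q K(2)] sum_window_move[OF K(3)])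
qed

lemma sum_list_move: "sum_list p = sum_list q + t"
proof -
  have "int (sum_list p) = int (sum_list q) + int t"
    using sum_contents_move[of "\<lambda>_. 1 :: int"] by (simp add: card_diagram)
  then show ?thesis by linarith
qed

text \<open>Only the hooks ending in \<open>x\<close> or starting in \<open>x + t\<close> are affected by the move.\<close>

lemma prod_hook_pairs_move:
  fixes f :: "int \<Rightarrow> real"
  defines "GL \<equiv> {a. a \<notin> beads q \<and> a < x \<and> int t dvd x - a}"
    and "BU \<equiv> {b \<in> beads q. x + int t < b \<and> int t dvd b - x}"
  obtains A where "A \<noteq> 0" and
    "(\<Prod>(a, b) \<in> hook_pairs t q. real_of_int (b - a)) =
       A * (\<Prod>a \<in> GL. real_of_int (x - a)) * (\<Prod>b \<in> BU. real_of_int (b - (x + int t)))"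
    "(\<Prod>(a, b) \<in> hook_pairs t p. real_of_int (b - a)) =
       A * (\<Prod>a \<in> GL. real_of_int (x + int t - a)) * (\<Prod>b \<in> BU. real_of_int (b - x)) * real t"
proof -
  let ?y = "x + int t"
  define A where "A = {(a, b) \<in> hook_pairs t q. b \<noteq> x \<and> a \<noteq> ?y}"
  have fin: "finite A" "finite GL" "finite BU"
  proof -
    show "finite A" unfolding A_def by (rule finite_subset[OF _ finite_hook_pairs[OF q, of t]]) auto
    show "finite GL" unfolding GL_def
      by (rule finite_subset[OF _ finite_gaps_less[of q x]]) auto
    show "finite BU" unfolding BU_def
      by (rule finite_subset[OF _ finite_beads_ge[OF q, of ?y]]) auto
  qed
  have dy: "int t dvd b - ?y \<longleftrightarrow> int t dvd b - x" for b
    using dvd_add_left_iff[of "int t" "- int t" "b - x"] by (simp add: algebra_simps)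
  have dy': "int t dvd ?y - a \<longleftrightarrow> int t dvd x - a" for a
    using dvd_add_left_iff[of "int t" "int t" "x - a"] by (simp add: algebra_simps)
  \<comment> \<open>No member of the residue class of \<open>x\<close> lies strictly between
    \<open>x\<close> and \<open>x + t\<close>.\<close>
  have y_le: "a \<le> x" if "a < ?y" "int t dvd x - a" for a
  proof (rule ccontr)
    assume "\<not> a \<le> x"
    then have "int t \<le> a - x" using that(2) by (intro zdvd_imp_le) (auto simp: dvd_diff_commute)
    then show False using that(1) by simp
  qed
  have yb: "?y < b" if "x < b" "b \<noteq> ?y" "int t dvd b - x" for b
    using y_le[of "b" ] that dvd_diff_commute[of "int t" x b] by force
  have hq: "hook_pairs t q = A \<union> ((\<lambda>a. (a, x)) ` GL \<union> (\<lambda>b. (?y, b)) ` BU)"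
    using x by (auto simp: A_def GL_def BU_def hook_pairs_def dy)
  \<comment> \<open>Hooks \<open>(a, x)\<close> turn into \<open>(a, x + t)\<close> and hooks
    \<open>(x + t, b)\<close> into \<open>(x, b)\<close>. The pair \<open>(x, x + t)\<close> is new
    and supplies the factor \<open>t\<close>.\<close>
  have hp: "hook_pairs t p = A \<union> ((\<lambda>a. (a, ?y)) ` GL \<union> ((\<lambda>b. (x, b)) ` BU \<union> {(x, ?y)}))"
  proof (intro equalityI subsetI)
    fix z assume "z \<in> hook_pairs t p"
    then obtain a b where z: "z = (a, b)" "a \<notin> beads p" "b \<in> beads p" "a < b" "int t dvd b - a"
      by (auto simp: hook_pairs_def)
    show "z \<in> A \<union> ((\<lambda>a. (a, ?y)) ` GL \<union> ((\<lambda>b. (x, b)) ` BU \<union> {(x, ?y)}))"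
    proof (cases "b = ?y")
      case True
      then have "a \<le> x" "int t dvd x - a" using y_le[of a] z dy' by auto
      then show ?thesis using z True by (cases "a = x") (auto simp: GL_def beads_p)
    next
      case False
      then show ?thesis using z yb[of b]
        by (cases "a = x") (auto simp: A_def BU_def beads_p hook_pairs_def)
    qed
  next
    fix z assume "z \<in> A \<union> ((\<lambda>a. (a, ?y)) ` GL \<union> ((\<lambda>b. (x, b)) ` BU \<union> {(x, ?y)}))"
    then show "z \<in> hook_pairs t p"
      using x t by (auto simp: A_def GL_def BU_def beads_p hook_pairs_def dy')
  qed
  show ?thesis
  proof
    have "real_of_int (b - a) \<noteq> 0" if "(a, b) \<in> A" for a b
      using that by (auto simp: A_def hook_pairs_def)
    then show "(\<Prod>(a, b) \<in> A. real_of_int (b - a)) \<noteq> 0"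
      using fin(1) by (auto simp: prod_zero_iff)
    show "(\<Prod>(a, b) \<in> hook_pairs t q. real_of_int (b - a)) =
       (\<Prod>(a, b) \<in> A. real_of_int (b - a)) * (\<Prod>a \<in> GL. real_of_int (x - a)) *
       (\<Prod>b \<in> BU. real_of_int (b - ?y))"
      unfolding hq using fin x t
      by (subst prod.union_disjoint; (subst prod.union_disjoint)?)
        (auto simp: A_def GL_def BU_def prod.reindex inj_on_def mult.assoc)
    show "(\<Prod>(a, b) \<in> hook_pairs t p. real_of_int (b - a)) =
       (\<Prod>(a, b) \<in> A. real_of_int (b - a)) * (\<Prod>a \<in> GL. real_of_int (?y - a)) *
       (\<Prod>b \<in> BU. real_of_int (b - x)) * real t"
    proof -
      have "A \<inter> ((\<lambda>a. (a, ?y)) ` GL \<union> ((\<lambda>b. (x, b)) ` BU \<union> {(x, ?y)})) = {}"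
        "(\<lambda>a. (a, ?y)) ` GL \<inter> ((\<lambda>b. (x, b)) ` BU \<union> {(x, ?y)}) = {}"
        "(\<lambda>b. (x, b)) ` BU \<inter> {(x, ?y)} = {}"
        using x t by (auto simp: A_def GL_def BU_def hook_pairs_def)
      then show ?thesis
        unfolding hp using fin
        by (simp add: prod.union_disjoint prod.reindex inj_on_def mult.assoc del: Un_insert_right)
    qed
  qed
qed

end

section \<open>Moments of the Kerov transition weights\<close>

text \<open>
  The interlacing sequences of Kerov's transition measure are, after cancellation, the points \<open>f b\<close>
  and the points \<open>f b - t\<close> with \<open>b \<noteq> a\<^sub>0\<close>. The lowest bead \<open>a\<^sub>0\<close> is exempt because it stands for the
  infinitely many beads below it. Beads that cannot move get weight 0.
\<close>

definition kerov_weight :: "('a \<Rightarrow> real) \<Rightarrow> real \<Rightarrow> 'a \<Rightarrow> 'a set \<Rightarrow> 'a \<Rightarrow> real" where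
  "kerov_weight f t a\<^sub>0 A a = (\<Prod>b \<in> A - {a\<^sub>0}. f a + t - f b) / (\<Prod>b \<in> A - {a}. f a - f b)"

text \<open>Factors of the form 1 - f(b) X put the elementary symmetric functions into the lowest
  degrees, whatever the size of \<open>A\<close>. Degree 2 is expressed by power sums, so that
  deleting a point becomes a subtraction.\<close>

lemma coeff_prod_linear:
  fixes f :: "'a \<Rightarrow> real"
  assumes "finite A"
  shows "coeff (\<Prod>b\<in>A. [:1, - f b:]) 0 = 1"
    "coeff (\<Prod>b\<in>A. [:1, - f b:]) 1 = - (\<Sum>b\<in>A. f b)"
    "coeff (\<Prod>b\<in>A. [:1, - f b:]) 2 = ((\<Sum>b\<in>A. f b)\<^sup>2 - (\<Sum>b\<in>A. (f b)\<^sup>2)) / 2"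
  using assms
  by (induction A rule: finite_induct)
    (auto simp: coeff_pCons numeral_2_eq_2 power2_eq_square algebra_simps field_simps)

lemma degree_prod_linear_le:
  fixes f :: "'a \<Rightarrow> real"
  shows "degree (\<Prod>b\<in>A. [:1, - f b:]) \<le> card A"
proof (cases "finite A")
  case True
  have "degree (\<Prod>b\<in>A. [:1, - f b:]) \<le> (\<Sum>b\<in>A. degree [:1, - f b:])"
    using degree_prod_sum_le[OF True, of "\<lambda>b. [:1, - f b:]"] by (simp add: o_def)
  also have "\<dots> \<le> (\<Sum>b\<in>A. 1)" by (intro sum_mono) auto
  finally show ?thesis by simp
qed simp

text \<open>Lagrange interpolation of the left-hand side at the points \<open>1 / f a\<close>.\<close>

lemma kerov_weight_poly:
  assumes A: "finite A" "a\<^sub>0 \<in> A" and inj: "inj_on f A" and nz: "\<And>a. a \<in> A \<Longrightarrow> f a \<noteq> 0"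
  shows "(\<Prod>b \<in> A - {a\<^sub>0}. [:1, - (f b - t):]) =
    (\<Sum>a\<in>A. smult (kerov_weight f t a\<^sub>0 A a) (\<Prod>b \<in> A - {a}. [:1, - f b:]))" (is "?P = ?Q")
proof -
  have card: "card (A - {a}) = card A - 1" "card A > 0" if "a \<in> A" for a
    using A that by (auto simp: card_gt_0_iff)
  have "degree ?P \<le> card A - 1"
    using degree_prod_linear_le[of "\<lambda>b. f b - t" "A - {a\<^sub>0}"] card[OF A(2)] by simp
  moreover have "degree (smult c (\<Prod>b \<in> A - {a}. [:1, - f b:])) \<le> card A - 1" if "a \<in> A" for a c
    using order_trans[OF degree_smult_le degree_prod_linear_le[of f "A - {a}"]] card(1)[OF that] by simp
  then have "degree ?Q \<le> card A - 1"
    using A(1) by (intro degree_sum_le)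
  ultimately have deg: "degree (?P - ?Q) < card A"
    using degree_diff_le[of ?P "card A - 1" ?Q] card(2)[OF A(2)] by linarith
  \<comment> \<open>All products have \<open>card A - 1\<close> factors, so the same power of
    \<open>f a\<close> is divided out on both sides; every summand with another index contains a
    factor that vanishes at \<open>1 / f a\<close>.\<close>
  have root: "poly (?P - ?Q) (1 / f a) = 0" if a: "a \<in> A" for a
  proof -
    have fa: "f a \<noteq> 0" using nz a .
    have ev: "poly (\<Prod>b \<in> B. [:1, - g b:]) (1 / f a) = (\<Prod>b \<in> B. f a - g b) / f a ^ card B" for B g
    proof -
      have "poly (\<Prod>b \<in> B. [:1, - g b:]) (1 / f a) = (\<Prod>b \<in> B. (f a - g b) / f a)"
        unfolding poly_prod using fa by (intro prod.cong) (auto simp: field_simps)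
      then show ?thesis by (simp add: prod_dividef)
    qed
    have zero: "(\<Prod>b \<in> A - {c}. f a - f b) = 0" if "c \<in> A - {a}" for c
      using that a A by (auto simp: prod_zero_iff)
    have nonzero: "(\<Prod>b \<in> A - {a}. f a - f b) \<noteq> 0"
      using A inj a by (auto simp: prod_zero_iff inj_on_def)
    have "poly ?Q (1 / f a) = (\<Sum>c\<in>A. kerov_weight f t a\<^sub>0 A c * (\<Prod>b \<in> A - {c}. f a - f b) / f a ^ (card A - 1))"
      by (simp add: poly_sum ev card)
    also have "\<dots> = kerov_weight f t a\<^sub>0 A a * (\<Prod>b \<in> A - {a}. f a - f b) / f a ^ (card A - 1)"
      using zero A a by (subst sum.remove[of _ a]) (auto simp: sum.neutral)
    also have "\<dots> = poly ?P (1 / f a)"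
      using nonzero card(1)[OF A(2)]
      by (simp only: ev kerov_weight_def) (simp add: algebra_simps)
    finally show ?thesis by simp
  qed
  have "?P - ?Q = 0"
  proof (rule ccontr)
    assume ne: "?P - ?Q \<noteq> 0"
    have "card ((\<lambda>a. 1 / f a) ` A) \<le> card {z. poly (?P - ?Q) z = 0}"
      using root by (intro card_mono poly_roots_finite ne) auto
    also have "\<dots> \<le> degree (?P - ?Q)" by (rule card_poly_roots_bound[OF ne])
    finally show False using deg inj by (simp add: card_image inj_on_def)
  qed
  then show ?thesis by simp
qed

text \<open>Dividing the interpolation identity by the product of all 1 - f(b) X would exhibit the
  moments as power series coefficients; comparing coefficients of degree 0, 1, 2 amounts to the
  same. The mean \<open>u\<close> is the sum of the points \<open>f b\<close> minus that of the
  points \<open>f b - t\<close>. In the second moment the sum of squares \<open>s2\<close> cancels,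
  which leaves it linear in the sum of the \<open>f a\<close>.\<close>

lemma kerov_moments_nonzero:
  fixes t :: real
  assumes A: "finite A" "a\<^sub>0 \<in> A" and inj: "inj_on f A" and nz: "\<And>a. a \<in> A \<Longrightarrow> f a \<noteq> 0"
  defines "u \<equiv> f a\<^sub>0 + t * (real (card A) - 1)"
  shows "(\<Sum>a\<in>A. kerov_weight f t a\<^sub>0 A a) = 1"
    and "(\<Sum>a\<in>A. kerov_weight f t a\<^sub>0 A a * f a) = u"
    and "(\<Sum>a\<in>A. kerov_weight f t a\<^sub>0 A a * (f a)\<^sup>2) =
      (u\<^sup>2 + (f a\<^sub>0)\<^sup>2 + 2 * t * ((\<Sum>a\<in>A. f a) - f a\<^sub>0) - t\<^sup>2 * (real (card A) - 1)) / 2"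
proof -
  define w where "w = kerov_weight f t a\<^sub>0 A"
  define s where "s = (\<Sum>a\<in>A. f a)"
  define s2 where "s2 = (\<Sum>a\<in>A. (f a)\<^sup>2)"
  have rm: "(\<Sum>b\<in>A-{a}. f b) = s - f a" "(\<Sum>b\<in>A-{a}. (f b)\<^sup>2) = s2 - (f a)\<^sup>2" if "a \<in> A" for a
    using A that by (simp_all add: s_def s2_def sum_diff1)
  have c0: "real (card (A - {a\<^sub>0})) = real (card A) - 1"
    using A card_gt_0_iff[of A] by (auto simp: of_nat_diff)
  have s0: "(\<Sum>b\<in>A-{a\<^sub>0}. f b - t) = s - u"
    using rm(1)[OF A(2)] c0 by (simp add: sum_subtractf u_def)
  have s20: "(\<Sum>b\<in>A-{a\<^sub>0}. (f b - t)\<^sup>2) = s2 - (f a\<^sub>0)\<^sup>2 - 2 * t * (s - f a\<^sub>0) + t\<^sup>2 * (real (card A) - 1)"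
    using rm[OF A(2)] c0
    by (simp add: power2_diff sum.distrib sum_subtractf sum_distrib_left[symmetric] sum_distrib_right[symmetric])
  have fin: "finite (A - {a})" for a using A by simp
  have co: "coeff (\<Prod>b \<in> A - {a\<^sub>0}. [:1, - (f b - t):]) k =
      (\<Sum>a\<in>A. w a * coeff (\<Prod>b \<in> A - {a}. [:1, - f b:]) k)" for k
    by (subst kerov_weight_poly[OF A inj nz, of t]) (auto simp: coeff_sum w_def)
  show m0: "(\<Sum>a\<in>A. kerov_weight f t a\<^sub>0 A a) = 1"
    using co[of 0] by (simp only: coeff_prod_linear[OF fin] w_def mult_1_right)
  have "- (s - u) = (\<Sum>a\<in>A. w a * - (s - f a))"
    using co[of 1] rm(1) by (simp only: coeff_prod_linear[OF fin] s0 cong: sum.cong)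
  also have "\<dots> = (\<Sum>a\<in>A. w a * f a) - s * (\<Sum>a\<in>A. w a)"
    by (simp add: sum_distrib_left sum_subtractf[symmetric] algebra_simps)
  finally show m1: "(\<Sum>a\<in>A. kerov_weight f t a\<^sub>0 A a * f a) = u"
    using m0 by (simp add: w_def)
  have "((s - u)\<^sup>2 - (s2 - (f a\<^sub>0)\<^sup>2 - 2 * t * (s - f a\<^sub>0) + t\<^sup>2 * (real (card A) - 1))) / 2 =
      (\<Sum>a\<in>A. w a * (((s - f a)\<^sup>2 - (s2 - (f a)\<^sup>2)) / 2))"
    using co[of 2] rm by (simp only: coeff_prod_linear[OF fin] s0 s20 cong: sum.cong)
  also have "\<dots> = (\<Sum>a\<in>A. (s\<^sup>2 - s2) / 2 * w a - s * (w a * f a) + w a * (f a)\<^sup>2)"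
    by (intro sum.cong) (auto simp: power2_eq_square field_simps)
  also have "\<dots> = (s\<^sup>2 - s2) / 2 * (\<Sum>a\<in>A. w a) - s * (\<Sum>a\<in>A. w a * f a) + (\<Sum>a\<in>A. w a * (f a)\<^sup>2)"
    by (simp only: sum_distrib_left sum.distrib sum_subtractf)
  finally show "(\<Sum>a\<in>A. kerov_weight f t a\<^sub>0 A a * (f a)\<^sup>2) =
      (u\<^sup>2 + (f a\<^sub>0)\<^sup>2 + 2 * t * ((\<Sum>a\<in>A. f a) - f a\<^sub>0) - t\<^sup>2 * (real (card A) - 1)) / 2"
    using m0 m1 unfolding w_def[symmetric] s_def[symmetric]
    by (simp add: power2_eq_square field_simps)
qed

text \<open>The weights involve only differences of values, so translating by \<open>s\<close>
  leaves them unchanged and makes every value positive. The moments are then translated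
  back.\<close>

lemma kerov_moments:
  fixes t :: real
  assumes A: "finite A" "a\<^sub>0 \<in> A" and inj: "inj_on f A"
  defines "u \<equiv> f a\<^sub>0 + t * (real (card A) - 1)"
  shows "(\<Sum>a\<in>A. kerov_weight f t a\<^sub>0 A a) = 1"
    and "(\<Sum>a\<in>A. kerov_weight f t a\<^sub>0 A a * f a) = u"
    and "(\<Sum>a\<in>A. kerov_weight f t a\<^sub>0 A a * (f a)\<^sup>2) =
      (u\<^sup>2 + (f a\<^sub>0)\<^sup>2 + 2 * t * ((\<Sum>a\<in>A. f a) - f a\<^sub>0) - t\<^sup>2 * (real (card A) - 1)) / 2"
proof -
  define s where "s = (\<Sum>a\<in>A. \<bar>f a\<bar>) + 1"
  define g where "g a = f a + s" for a
  have nz: "g a \<noteq> 0" if "a \<in> A" for a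
    using member_le_sum[of a A "\<lambda>a. \<bar>f a\<bar>"] that A by (auto simp: g_def s_def)
  have inj': "inj_on g A" using inj by (auto simp: g_def inj_on_def)
  have w: "kerov_weight g t a\<^sub>0 A = kerov_weight f t a\<^sub>0 A"
    by (simp add: kerov_weight_def g_def fun_eq_iff algebra_simps)
  note m = kerov_moments_nonzero[OF A inj' nz, of t, unfolded w]
  show m0: "(\<Sum>a\<in>A. kerov_weight f t a\<^sub>0 A a) = 1" using m(1) by simp
  have "(\<Sum>a\<in>A. kerov_weight f t a\<^sub>0 A a * g a) =
      (\<Sum>a\<in>A. kerov_weight f t a\<^sub>0 A a * f a) + s * (\<Sum>a\<in>A. kerov_weight f t a\<^sub>0 A a)"
    by (simp add: g_def sum_distrib_left sum.distrib algebra_simps)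
  then show m1: "(\<Sum>a\<in>A. kerov_weight f t a\<^sub>0 A a * f a) = u"
    using m(2) m0 by (simp add: u_def g_def)
  have sg: "(\<Sum>a\<in>A. g a) = (\<Sum>a\<in>A. f a) + s * real (card A)"
    by (simp add: g_def sum.distrib)
  have "(\<Sum>a\<in>A. kerov_weight f t a\<^sub>0 A a * (g a)\<^sup>2) =
      (\<Sum>a\<in>A. kerov_weight f t a\<^sub>0 A a * (f a)\<^sup>2) + 2 * s * (\<Sum>a\<in>A. kerov_weight f t a\<^sub>0 A a * f a)
      + s\<^sup>2 * (\<Sum>a\<in>A. kerov_weight f t a\<^sub>0 A a)"
    by (simp add: g_def sum_distrib_left sum.distrib algebra_simps power2_eq_square)
  then show "(\<Sum>a\<in>A. kerov_weight f t a\<^sub>0 A a * (f a)\<^sup>2) =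
      (u\<^sup>2 + (f a\<^sub>0)\<^sup>2 + 2 * t * ((\<Sum>a\<in>A. f a) - f a\<^sub>0) - t\<^sup>2 * (real (card A) - 1)) / 2"
    using m(3) unfolding m0 m1 sg by (simp add: u_def g_def power2_eq_square field_simps)
qed

section \<open>Adding a hook on a runner\<close>

text \<open>In use, \<open>r\<close> is the lowest position of its residue class at or above
  \<open>- K\<close>. It is a bead once \<open>length p + t \<le> K\<close>, and takes the part of
  the exempt \<open>a\<^sub>0\<close>.\<close>

definition runner :: "nat \<Rightarrow> nat \<Rightarrow> nat list \<Rightarrow> int \<Rightarrow> int set" where
  "runner t K p r = {x \<in> window K p. int t dvd x - r}"

lemma finite_runner: "is_partition p \<Longrightarrow> finite (runner t K p r)"
  by (simp add: runner_def finite_window)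

lemma residue_ge:
  fixes x r :: int
  assumes "int t dvd x - r" "- int K \<le> x" "r < - int K + int t"
  shows "r \<le> x"
proof (rule ccontr)
  assume "\<not> r \<le> x"
  then have "int t \<le> r - x" using assms(1) by (intro zdvd_imp_le) (auto simp: dvd_diff_commute)
  then show False using assms by simp
qed

text \<open>With \<open>x - c = t * i\<close> the factors become \<open>i / (i + 1)\<close>. The
  formula serves to trade a product over the non-beads of a class below \<open>x\<close> for one
  over its beads.\<close>

lemma telescope_prod:
  fixes x r :: int
  assumes t: "t > 0" and xr: "r < x" "int t dvd x - r"
  shows "(\<Prod>c | r < c \<and> c < x \<and> int t dvd x - c. real_of_int (x - c) / real_of_int (x + int t - c)) =
    real t / real_of_int (x - r)"
proof -
  obtain m where m: "x - r = int t * m" using xr(2) by blast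
  then have "m > 0" using xr(1) t by (smt (verit) mult_nonneg_nonpos of_nat_0_le_iff)
  then obtain n where n: "m = int (Suc n)" using gr0_implies_Suc zero_less_imp_eq_int by metis
  have "(\<Prod>c | r < c \<and> c < x \<and> int t dvd x - c. real_of_int (x - c) / real_of_int (x + int t - c)) =
    (\<Prod>i = 1..n. real i / real (Suc i))"
  proof (rule prod.reindex_bij_witness[where i = "\<lambda>i. x - int t * int i" and j = "\<lambda>c. nat ((x - c) div int t)"])
    fix c assume c: "c \<in> {c. r < c \<and> c < x \<and> int t dvd x - c}"
    then obtain k where k: "x - c = int t * k" by blast
    have "0 < int t * k" "int t * k < int t * m" using k m c by auto
    then have k0: "0 < k" "k < m" using t by (auto simp: zero_less_mult_iff)
    have d: "(x - c) div int t = k" using k t by simp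
    show "x - int t * int (nat ((x - c) div int t)) = c" using d k k0 by simp
    show "nat ((x - c) div int t) \<in> {1..n}" using d k0 n by auto
    have "x + int t - c = int t * (k + 1)" using k by (simp add: algebra_simps)
    then show "real (nat ((x - c) div int t)) / real (Suc (nat ((x - c) div int t))) =
        real_of_int (x - c) / real_of_int (x + int t - c)"
      using d k k0 t by (simp add: add.commute)
  next
    fix i assume i: "i \<in> {1..n}"
    show "nat ((x - (x - int t * int i)) div int t) = i" using t by simp
    have "int t * int i < int t * m" using i n t by auto
    then have "r < x - int t * int i" using m by linarith
    then show "x - int t * int i \<in> {c. r < c \<and> c < x \<and> int t dvd x - c}" using i t by auto
  qed
  also have "\<dots> = 1 / real (Suc n)"
    by (induction n) (auto simp: field_simps)
  also have "\<dots> = real t / real_of_int (x - r)"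
    using m n t by simp
  finally show ?thesis .
qed

context hook_move begin

text \<open>The change of \<open>G\<close> is a product over non-beads below \<open>x\<close> and
  beads above \<open>x + t\<close>, while the Kerov weight involves beads only.
  \<open>telescope_prod\<close>, applied to all positions of the class between \<open>r\<close> and
  \<open>x\<close>, converts one into the other.\<close>

lemma G_move:
  assumes K: "length q + 2 * t \<le> K" and r: "- int K \<le> r" "r < - int K + int t" "int t dvd x - r"
  shows "G t p = G t q * (kerov_weight real_of_int (real t) r (runner t K q r) x / real t)"
proof -
  let ?y = "x + int t"
  define GL where "GL = {a. a \<notin> beads q \<and> a < x \<and> int t dvd x - a}"
  define BU where "BU = {b \<in> beads q. ?y < b \<and> int t dvd b - x}"
  define BL where "BL = {b \<in> beads q. r < b \<and> b < x \<and> int t dvd x - b}"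
  define C where "C = {c. r < c \<and> c < x \<and> int t dvd x - c}"
  obtain A where "A \<noteq> 0" and
    Pq: "(\<Prod>(a, b) \<in> hook_pairs t q. real_of_int (b - a)) =
       A * (\<Prod>a \<in> GL. real_of_int (x - a)) * (\<Prod>b \<in> BU. real_of_int (b - ?y))" and
    Pp: "(\<Prod>(a, b) \<in> hook_pairs t p. real_of_int (b - a)) =
       A * (\<Prod>a \<in> GL. real_of_int (?y - a)) * (\<Prod>b \<in> BU. real_of_int (b - x)) * real t"
    using prod_hook_pairs_move unfolding GL_def BU_def by blast
  have xK: "- int K \<le> x" using bead_ge_window[of K] K by simp
  have low: "y \<in> beads q" if "y < - int (length q)" for y using low_beads[of q "length q"] that by simp
  \<comment> \<open>The spare \<open>2 * t\<close> in \<open>K\<close> makes both \<open>r\<close>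
    and \<open>r + t\<close> beads. Hence \<open>r\<close> cannot move, and \<open>x\<close> lies
    strictly above it.\<close>
  have rt: "r + int t \<in> beads q" "r \<in> beads q" using low K r by auto
  then have rx: "r < x" using residue_ge[OF r(3) xK r(2)] x(2) by (auto simp: order_le_less)
  have y_le: "a \<le> x" if "a < ?y" "int t dvd x - a" for a
  proof (rule ccontr)
    assume "\<not> a \<le> x"
    then have "int t \<le> a - x" using that(2) by (intro zdvd_imp_le) (auto simp: dvd_diff_commute)
    then show False using that(1) by simp
  qed
  have dvd_r: "int t dvd b - r \<longleftrightarrow> int t dvd x - b" for b
    using dvd_diff[OF r(3), of "x - b"] dvd_diff[OF r(3), of "b - r"] by auto
  have fin: "finite GL" "finite BU" "finite BL"
  proof -
    show "finite GL" unfolding GL_def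
      by (rule finite_subset[OF _ finite_gaps_less[of q x]]) auto
    show "finite BU" unfolding BU_def
      by (rule finite_subset[OF _ finite_beads_ge[OF q, of ?y]]) auto
    show "finite BL" unfolding BL_def
      by (rule finite_subset[OF _ finite_beads_ge[OF q, of r]]) auto
  qed
  have C: "C = GL \<union> BL" "GL \<inter> BL = {}"
    using low K r by (force simp: C_def GL_def BL_def)+
  have run: "runner t K q r = {r} \<union> BL \<union> {x} \<union> BU"
  proof (intro equalityI subsetI)
    fix b assume "b \<in> runner t K q r"
    then have b: "b \<in> beads q" "- int K \<le> b" "int t dvd b - r" "int t dvd x - b"
      by (auto simp: runner_def window_def dvd_r)
    have "r \<le> b" using residue_ge[OF b(3,2) r(2)] .
    moreover have "b \<noteq> ?y" using b x by blast
    moreover have "int t dvd b - x" using b(4) by (simp add: dvd_diff_commute)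
    moreover have "b \<le> x" if "b < ?y" using y_le that b by blast
    ultimately show "b \<in> {r} \<union> BL \<union> {x} \<union> BU"
      using b by (fastforce simp: BL_def BU_def)
  next
    fix b assume "b \<in> {r} \<union> BL \<union> {x} \<union> BU"
    then show "b \<in> runner t K q r"
      using x r rt rx xK by (auto simp: runner_def window_def BL_def BU_def dvd_r dvd_diff_commute)
  qed
  have n1: "runner t K q r - {r} = insert x (BL \<union> BU)" "x \<notin> BL \<union> BU"
    and n2: "runner t K q r - {x} = insert r (BL \<union> BU)" "r \<notin> BL \<union> BU" "BL \<inter> BU = {}"
    using rx unfolding run by (auto simp: BL_def BU_def)
  define gy where "gy = (\<Prod>a \<in> GL. real_of_int (?y - a))"
  define gx where "gx = (\<Prod>a \<in> GL. real_of_int (x - a))"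
  define ly where "ly = (\<Prod>a \<in> BL. real_of_int (?y - a))"
  define lx where "lx = (\<Prod>a \<in> BL. real_of_int (x - a))"
  define uy where "uy = (\<Prod>b \<in> BU. real_of_int (b - ?y))"
  define ux where "ux = (\<Prod>b \<in> BU. real_of_int (b - x))"
  have nz: "gy \<noteq> 0" "gx \<noteq> 0" "ly \<noteq> 0" "lx \<noteq> 0" "uy \<noteq> 0" "ux \<noteq> 0"
    using fin unfolding gy_def gx_def ly_def lx_def uy_def ux_def
    by (auto simp: prod_zero_iff GL_def BL_def BU_def)
  define d where "d = real_of_int (x - r)"
  have d: "d \<noteq> 0" using rx by (simp add: d_def)
  have tele: "gx / gy * (lx / ly) = real t / d"
    using telescope_prod[OF t rx r(3)] fin C
    unfolding C_def[symmetric] gx_def gy_def lx_def ly_def d_def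
    by (simp add: prod.union_disjoint prod_dividef)
  \<comment> \<open>For the beads above \<open>x + t\<close> the differences have the opposite sign
    in the weight; the two sign factors cancel in the quotient.\<close>
  have sgn: "(\<Prod>b \<in> BU. real_of_int x + real t - real_of_int b) = (-1) ^ card BU * uy"
      "(\<Prod>b \<in> BU. real_of_int x - real_of_int b) = (-1) ^ card BU * ux"
    unfolding uy_def ux_def prod_constant[symmetric] prod.distrib[symmetric]
    by (auto intro!: prod.cong)
  have "kerov_weight real_of_int (real t) r (runner t K q r) x =
      real t * ly * uy / (d * lx * ux)"
    unfolding kerov_weight_def n1(1) n2(1)
    using fin n1(2) n2(2,3) by (simp add: prod.union_disjoint sgn ly_def lx_def d_def)
  moreover have "G t p = G t q * ((gx / gy) * uy / (ux * real t))"
  proof -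
    have Gp: "G t p = 1 / (A * gy * ux * real t)"
      by (simp only: G_hook_pairs[OF p] Pp gy_def ux_def)
    have Gq: "G t q = 1 / (A * gx * uy)"
      by (simp only: G_hook_pairs[OF q] Pq gx_def uy_def)
    show ?thesis unfolding Gp Gq using nz \<open>A \<noteq> 0\<close> t by (simp add: field_simps)
  qed
  moreover have "gx / gy = real t / d * (ly / lx)"
    using tele nz d by (simp add: field_simps)
  ultimately show ?thesis using nz d t by simp
qed

text \<open>A step by \<open>t\<close> stays in its residue class. The bead counts of the runners
  are thus invariants, shared by a partition and its core.\<close>

lemma card_runner_move:
  assumes "length q + t \<le> K"
  shows "card (runner t K p r) = card (runner t K q r)"
proof (cases "int t dvd x - r")
  case True
  have "int t dvd x + int t - r" using True by (metis dvd_add_triv_right_iff add_diff_eq diff_add_eq)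
  then have eq: "runner t K p r = insert (x + int t) (runner t K q r - {x})"
    using window_move[OF assms] by (auto simp: runner_def)
  have xr: "x \<in> runner t K q r" using x True bead_ge_window[OF assms] by (simp add: runner_def window_def)
  have "x + int t \<notin> runner t K q r" using x by (simp add: runner_def window_def)
  moreover have "card (runner t K q r) > 0" using xr finite_runner[OF q] card_gt_0_iff by blast
  ultimately show ?thesis using xr unfolding eq by (simp add: finite_runner[OF q])
next
  case False
  have "\<not> int t dvd x + int t - r" using False by (metis dvd_add_triv_right_iff add_diff_eq diff_add_eq)
  then have "runner t K p r = runner t K q r"
    using window_move[OF assms] False by (auto simp: runner_def)
  then show ?thesis by simp
qed

end

section \<open>Sums over added hooks as sums over runners\<close>

lemma adds_hook_iff_hook_move:
  "t > 0 \<Longrightarrow> adds_hook t q p \<longleftrightarrow> (\<exists>x. hook_move t q p x)"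
  by (auto simp: adds_hook_iff hook_move_def)

lemma kerov_weight_immovable:
  assumes "x + int t \<in> runner t K q r" "x + int t \<noteq> r" "finite (runner t K q r)"
  shows "kerov_weight real_of_int (real t) r (runner t K q r) x = 0"
proof -
  have "(\<Prod>b \<in> runner t K q r - {r}. real_of_int x + real t - real_of_int b) = 0"
    using assms by (intro prod_zero bexI[of _ "x + int t"]) auto
  then show ?thesis by (simp add: kerov_weight_def)
qed

lemma window_runners:
  assumes t: "t > 0"
  shows "window K p = (\<Union>r \<in> {- int K..<- int K + int t}. runner t K p r)"
    and "r \<in> {- int K..<- int K + int t} \<Longrightarrow> r' \<in> {- int K..<- int K + int t} \<Longrightarrow> r \<noteq> r' \<Longrightarrow>
      runner t K p r \<inter> runner t K p r' = {}"
proof -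
  show "window K p = (\<Union>r \<in> {- int K..<- int K + int t}. runner t K p r)"
  proof (intro equalityI subsetI)
    fix x assume x: "x \<in> window K p"
    define r where "r = - int K + (x + int K) mod int t"
    have "int t dvd (x + int K) - (x + int K) mod int t" by (rule dvd_minus_mod)
    then have "int t dvd x - r" by (simp add: r_def algebra_simps)
    moreover have "r \<in> {- int K..<- int K + int t}" using t by (simp add: r_def)
    ultimately show "x \<in> (\<Union>r \<in> {- int K..<- int K + int t}. runner t K p r)"
      using x by (auto simp: runner_def)
  qed (auto simp: runner_def)
  assume r: "r \<in> {- int K..<- int K + int t}" "r' \<in> {- int K..<- int K + int t}" "r \<noteq> r'"
  show "runner t K p r \<inter> runner t K p r' = {}"
  proof (rule ccontr)
    assume "runner t K p r \<inter> runner t K p r' \<noteq> {}"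
    then obtain x where "int t dvd x - r" "int t dvd x - r'" by (auto simp: runner_def)
    then have "int t dvd r - r'" "int t dvd r' - r" using dvd_diff[of "int t" "x - r'" "x - r"]
        dvd_diff[of "int t" "x - r" "x - r'"] by simp_all
    then have "r \<le> r'" "r' \<le> r" using r residue_ge[of t r r' K] residue_ge[of t r' r K] by auto
    then show False using r(3) by simp
  qed
qed

lemma sum_window_runners:
  assumes "t > 0" "is_partition p"
  shows "(\<Sum>x \<in> window K p. f x) = (\<Sum>r = - int K..<- int K + int t. \<Sum>x \<in> runner t K p r. f x)"
  unfolding window_runners(1)[OF assms(1)]
  using window_runners(2)[OF assms(1)] finite_runner[OF assms(2)] by (intro sum.UNION_disjoint) auto

text \<open>Beads that cannot move have weight 0, so the sum over movable beads extends to the whole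
  window and splits into one weighted mean per runner.\<close>

lemma sum_adds_hook:
  assumes t: "t > 0" and q: "is_partition q" and K: "length q + 2 * t \<le> K"
    and g: "\<And>p x. hook_move t q p x \<Longrightarrow> g p = h x"
  shows "(\<Sum>p | adds_hook t q p. G t p * g p) = G t q *
    (\<Sum>r = - int K..<- int K + int t. \<Sum>x \<in> runner t K q r.
      kerov_weight real_of_int (real t) r (runner t K q r) x * (h x / real t))"
proof -
  define M where "M = {x \<in> beads q. x + int t \<notin> beads q}"
  define w where "w r x = kerov_weight real_of_int (real t) r (runner t K q r) x" for r x
  define mv where "mv x = (SOME p. hook_move t q p x)" for x
  have mv: "hook_move t q (mv x) x" if "x \<in> M" for x
  proof -
    have x: "x \<in> beads q" "x + int t \<notin> beads q" using that by (auto simp: M_def)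
    obtain p where "is_partition p" "beads p = insert (x + int t) (beads q - {x})"
      using partition_move_bead[OF q x] .
    then have "hook_move t q p x" using x t q by unfold_locales
    then have "\<exists>p. hook_move t q p x" ..
    then show ?thesis unfolding mv_def by (rule someI_ex)
  qed
  have uniq: "p = mv x" if "hook_move t q p x" for p x
  proof -
    have "x \<in> M" using that by (simp add: M_def hook_move_def)
    then show ?thesis using mv[of x] that beads_inj[of p "mv x"] by (simp add: hook_move_def)
  qed
  have inj: "inj_on mv M"
  proof (rule inj_onI)
    fix x x' assume "x \<in> M" "x' \<in> M" "mv x = mv x'"
    then have "insert (x + int t) (beads q - {x}) = insert (x' + int t) (beads q - {x'})"
      using mv[of x] mv[of x'] by (simp add: hook_move_def)
    then show "x = x'" using \<open>x \<in> M\<close> \<open>x' \<in> M\<close> t by (auto simp: M_def)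
  qed
  have img: "{p. adds_hook t q p} = mv ` M"
  proof (intro equalityI subsetI)
    fix p assume "p \<in> {p. adds_hook t q p}"
    then obtain x where x: "hook_move t q p x" by (auto simp: adds_hook_iff_hook_move[OF t])
    then have "x \<in> M" by (simp add: M_def hook_move_def)
    then show "p \<in> mv ` M" using uniq[OF x] by blast
  next
    fix p assume "p \<in> mv ` M"
    then show "p \<in> {p. adds_hook t q p}" using mv by (auto simp: adds_hook_iff_hook_move[OF t])
  qed
  let ?S = "\<lambda>r. \<Sum>x \<in> runner t K q r. w r x * (h x / real t)"
  have MW: "M \<subseteq> window K q"
    using K hook_move.bead_ge_window[OF mv, of _ K] by (auto simp: window_def M_def)
  have "(\<Sum>p | adds_hook t q p. G t p * g p) = (\<Sum>x\<in>M. G t (mv x) * h x)"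
    unfolding img by (simp add: sum.reindex[OF inj] g[OF mv] cong: sum.cong)
  also have "\<dots> = (\<Sum>x \<in> window K q. if x \<in> M then G t (mv x) * h x else 0)"
    using MW finite_window[OF q] by (simp add: sum.inter_restrict[symmetric] Int_absorb1)
  also have "\<dots> = (\<Sum>r = - int K..<- int K + int t. \<Sum>x \<in> runner t K q r.
      if x \<in> M then G t (mv x) * h x else 0)"
    by (rule sum_window_runners[OF t q])
  also have "\<dots> = (\<Sum>r = - int K..<- int K + int t. G t q * ?S r)"
  proof (rule sum.cong[OF refl])
    fix r assume r: "r \<in> {- int K..<- int K + int t}"
    have "(if x \<in> M then G t (mv x) * h x else 0) = G t q * (w r x * (h x / real t))"
      if xr: "x \<in> runner t K q r" for x
    proof (cases "x \<in> M")
      case True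
      then show ?thesis
        using hook_move.G_move[OF mv[OF True] K, of r] r xr by (simp add: w_def runner_def)
    next
      case False
      then have "x + int t \<in> runner t K q r"
        using xr dvd_add_left_iff[of "int t" "int t" "x - r"]
        by (auto simp: M_def runner_def window_def algebra_simps)
      \<comment> \<open>The numerator of the weight omits \<open>r\<close>, so it vanishes only if
        the blocking bead \<open>x + t\<close> differs from \<open>r\<close>; indeed
        \<open>x \<ge> - K\<close> and \<open>r < - K + t\<close>.\<close>
      moreover have "x + int t \<noteq> r"
        using xr r by (auto simp: runner_def window_def)
      ultimately show ?thesis using False
        by (simp add: w_def kerov_weight_immovable finite_runner[OF q])
    qed
    then show "(\<Sum>x \<in> runner t K q r. if x \<in> M then G t (mv x) * h x else 0) = G t q * ?S r"
      by (simp add: sum_distrib_left cong: sum.cong)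
  qed
  finally show ?thesis by (simp add: sum_distrib_left w_def)
qed

section \<open>Summation over the partitions with a given core\<close>

lemma sum_list_runners:
  assumes t: "t > 0" and p: "is_partition p" and K: "length p \<le> K"
  shows "real (sum_list p) = (\<Sum>r = - int K..<- int K + int t. \<Sum>x \<in> runner t K p r. real_of_int x)
    + real K * (real K + 1) / 2"
  using sum_list_window[OF p K] sum_window_runners[OF t p] by metis

lemma sum_card_runners:
  assumes t: "t > 0" and p: "is_partition p" and K: "length p \<le> K"
  shows "(\<Sum>r = - int K..<- int K + int t. real (card (runner t K p r))) = real K"
proof -
  have "(\<Sum>x \<in> window K p. 1 :: real) = real K"
    using card_beads_above[OF p K] by (simp add: window_def)
  then show ?thesis unfolding sum_window_runners[OF t p] by simp
qed

text \<open>Without hooks of length \<open>t\<close> the beads of a runner are closed downwards, so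
  they form an arithmetic progression starting at \<open>r\<close>.\<close>

lemma runner_core:
  assumes t: "t > 0" and p: "is_partition p" and core: "hook_pairs t p = {}"
    and r: "- int K \<le> r" "r < - int K + int t"
  shows "(\<Sum>x \<in> runner t K p r. real_of_int x) =
    real (card (runner t K p r)) * real_of_int r +
    real t * real (card (runner t K p r)) * (real (card (runner t K p r)) - 1) / 2"
proof -
  define I where "I = {i. r + int t * int i \<in> beads p}"
  have inj: "inj_on (\<lambda>i. r + int t * int i) A" for A using t by (auto simp: inj_on_def)
  have run: "runner t K p r = (\<lambda>i. r + int t * int i) ` I"
  proof (intro equalityI subsetI)
    fix x assume x: "x \<in> runner t K p r"
    then have "r \<le> x" using residue_ge[of t x r K] r by (auto simp: runner_def window_def)
    moreover obtain k where k: "x - r = int t * k" using x by (auto simp: runner_def)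
    ultimately have "k \<ge> 0" using t by (metis diff_ge_0_iff_ge zero_le_mult_iff of_nat_0_less_iff leD)
    then show "x \<in> (\<lambda>i. r + int t * int i) ` I"
      using x k by (intro image_eqI[of _ _ "nat k"]) (auto simp: I_def runner_def window_def algebra_simps)
  next
    fix x assume "x \<in> (\<lambda>i. r + int t * int i) ` I"
    then show "x \<in> runner t K p r" using r
      by (auto simp: I_def runner_def window_def intro: order_trans[of _ r])
  qed
  then have fin: "finite I" using finite_runner[OF p] inj by (metis finite_imageD)
  have pred: "i \<in> I" if "Suc i \<in> I" for i
  proof (rule ccontr)
    assume "i \<notin> I"
    then have "(r + int t * int i, r + int t * int (Suc i)) \<in> hook_pairs t p"
      using that t by (auto simp: I_def hook_pairs_def algebra_simps)
    then show False using core by simp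
  qed
  define n where "n = (LEAST i. i \<notin> I)"
  obtain k where "k \<notin> I" using ex_new_if_finite[OF infinite_UNIV_nat fin] by blast
  then have "n \<notin> I" unfolding n_def by (rule LeastI)
  then have "i \<notin> I" if "n \<le> i" for i using that(1)
    by (rule_tac dec_induct[of n i "\<lambda>i. i \<notin> I"]) (use pred in blast)+
  moreover have "i \<in> I" if "i < n" for i using that not_less_Least n_def by blast
  ultimately have I: "I = {..<n}" by (auto simp: not_le[symmetric])
  have "(\<Sum>i<n. real_of_int r + real t * real i) = real n * real_of_int r + real t * real n * (real n - 1) / 2" for n
    by (induction n) (auto simp: field_simps)
  then show ?thesis
    unfolding run I by (simp add: sum.reindex[OF inj] card_image[OF inj])
qed

lemma sum_residues:
  "(\<Sum>r = - int K..<- int K + int t. real_of_int r) = - real t * real K + real t * (real t - 1) / 2"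
  "(\<Sum>r = - int K..<- int K + int t. (real_of_int r)\<^sup>2) =
    real t * (real K)\<^sup>2 - real K * real t * (real t - 1) + (real t - 1) * real t * (2 * real t - 1) / 6"
proof -
  have re: "(\<Sum>r = - int K..<- int K + int t. f r) = (\<Sum>i<t. f (int i - int K))" for f :: "int \<Rightarrow> real"
    by (rule sum.reindex_bij_witness[where i = "\<lambda>i. int i - int K" and j = "\<lambda>r. nat (r + int K)"]) auto
  show "(\<Sum>r = - int K..<- int K + int t. real_of_int r) = - real t * real K + real t * (real t - 1) / 2"
    unfolding re by (induction t) (auto simp: field_simps)
  show "(\<Sum>r = - int K..<- int K + int t. (real_of_int r)\<^sup>2) =
    real t * (real K)\<^sup>2 - real K * real t * (real t - 1) + (real t - 1) * real t * (2 * real t - 1) / 6"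
    unfolding re by (induction t) (auto simp: field_simps power2_eq_square)
qed

lemma sum_squares_interval:
  "(\<Sum>c = x + 1..x + int t. (real_of_int c)\<^sup>2) =
    real t * ((real_of_int x)\<^sup>2 + (real t + 1) * real_of_int x + (real t + 1) * (2 * real t + 1) / 6)"
proof -
  have "(\<Sum>c = x + 1..x + int t. (real_of_int c)\<^sup>2) = (\<Sum>i<t. (real_of_int x + real i + 1)\<^sup>2)"
    by (rule sum.reindex_bij_witness[where i = "\<lambda>i. x + 1 + int i" and j = "\<lambda>c. nat (c - x - 1)"]) auto
  also have "\<dots> = real t * ((real_of_int x)\<^sup>2 + (real t + 1) * real_of_int x + (real t + 1) * (2 * real t + 1) / 6)"
    by (induction t) (auto simp: field_simps power2_eq_square)
  finally show ?thesis .
qed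

lemma inj_real: "inj_on real_of_int A"
  by (simp add: inj_on_def)

text \<open>The weights on each of the \<open>t\<close> runners have total 1, and each runner enters
  with the factor \<open>1 / t\<close>.\<close>

lemma sum_G_adds_hook:
  assumes t: "t > 0" and q: "is_partition q"
  shows "(\<Sum>p | adds_hook t q p. G t p) = G t q"
proof -
  let ?K = "length q + 2 * t"
  let ?R = "{- int ?K..<- int ?K + int t}"
  have "(\<Sum>p | adds_hook t q p. G t p * 1) = G t q *
    (\<Sum>r \<in> ?R. \<Sum>x \<in> runner t ?K q r. kerov_weight real_of_int (real t) r (runner t ?K q r) x * (1 / real t))"
    by (rule sum_adds_hook[OF t q order_refl]) simp
  also have "(\<Sum>r \<in> ?R. \<Sum>x \<in> runner t ?K q r.
      kerov_weight real_of_int (real t) r (runner t ?K q r) x * (1 / real t)) = (\<Sum>r \<in> ?R. 1 / real t)"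
  proof (rule sum.cong[OF refl])
    fix r assume r: "r \<in> ?R"
    then have "r \<in> runner t ?K q r" using low_beads[of q "length q" r] by (auto simp: runner_def window_def)
    from kerov_moments(1)[OF finite_runner[OF q] this inj_real, of "real t"]
    show "(\<Sum>x \<in> runner t ?K q r. kerov_weight real_of_int (real t) r (runner t ?K q r) x * (1 / real t)) = 1 / real t"
      by (simp add: sum_divide_distrib[symmetric])
  qed
  also have "\<dots> = 1" using t by simp
  finally show ?thesis by simp
qed

definition content_energy :: "nat list \<Rightarrow> real" where
  "content_energy p = (\<Sum>b \<in> diagram p. (real_of_int (content b))\<^sup>2)"

lemma content_energy_move:
  assumes "hook_move t q p x"
  shows "content_energy p = content_energy q +
    real t * ((real_of_int x)\<^sup>2 + (real t + 1) * real_of_int x + (real t + 1) * (2 * real t + 1) / 6)"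
  using hook_move.sum_contents_move[OF assms, of "\<lambda>c. (real_of_int c)\<^sup>2"]
  by (simp add: content_energy_def sum_squares_interval)

text \<open>On runner \<open>r\<close> the mean is linear in the bead sum \<open>s r\<close>, which
  accounts for \<open>sum_list q\<close>. Its part quadratic in \<open>m r\<close> is matched with
  \<open>t\<close> times the bead sum of the runner of \<open>\<mu>\<close>, known from
  \<open>runner_core\<close> because \<open>card\<close> equates the bead counts.\<close>

lemma sum_G_content_energy_adds_hook:
  assumes t: "t > 0" and q: "is_partition q" and \<mu>: "is_partition \<mu>" and core: "hook_pairs t \<mu> = {}"
    and K: "length q + 2 * t \<le> K" "length \<mu> \<le> K"
    and card: "\<And>r. card (runner t K q r) = card (runner t K \<mu> r)"
  shows "(\<Sum>p | adds_hook t q p. G t p * content_energy p) =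
    G t q * (content_energy q + real t * (real (sum_list q) + real (sum_list \<mu>)) + (real t ^ 3 - real t) / 6)"
proof -
  let ?R = "{- int K..<- int K + int t}"
  define w where "w r x = kerov_weight real_of_int (real t) r (runner t K q r) x" for r x
  define m where "m r = real (card (runner t K q r))" for r
  define s where "s r = (\<Sum>x \<in> runner t K q r. real_of_int x)" for r
  define u where "u r = real_of_int r + real t * (m r - 1)" for r
  define c where "c = (real t + 1) * (2 * real t + 1) / 6"
  define \<rho> where "\<rho> = (\<lambda>r. real_of_int r)"
  let ?h = "\<lambda>x. content_energy q + real t * ((real_of_int x)\<^sup>2 + (real t + 1) * real_of_int x + c)"
  have inner: "(\<Sum>x \<in> runner t K q r. w r x * (?h x / real t)) =
      content_energy q / real t + (u r ^ 2 + \<rho> r ^ 2 + 2 * real t * (s r - \<rho> r) - (real t)\<^sup>2 * (m r - 1)) / 2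
      + (real t + 1) * u r + c" if r: "r \<in> ?R" for r
  proof -
    have mem: "r \<in> runner t K q r" using r low_beads[of q "length q" r] K(1)
      by (auto simp: runner_def window_def)
    note mom = kerov_moments[OF finite_runner[OF q] mem inj_real, of "real t", folded w_def s_def m_def]
    have "(\<Sum>x \<in> runner t K q r. w r x * (?h x / real t)) =
      (\<Sum>x \<in> runner t K q r. (content_energy q / real t + c) * w r x + w r x * (real_of_int x)\<^sup>2
        + (real t + 1) * (w r x * real_of_int x))"
      using t by (intro sum.cong) (auto simp: field_simps)
    also have "\<dots> = (content_energy q / real t + c) * (\<Sum>x \<in> runner t K q r. w r x) +
      (\<Sum>x \<in> runner t K q r. w r x * (real_of_int x)\<^sup>2) +
      (real t + 1) * (\<Sum>x \<in> runner t K q r. w r x * real_of_int x)"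
      by (simp only: sum_distrib_left sum.distrib)
    finally show ?thesis using mom by (simp add: u_def \<rho>_def)
  qed
  have cardR: "real (card ?R) = real t" by simp
  have sq: "real (sum_list q) = (\<Sum>r\<in>?R. s r) + real K * (real K + 1) / 2"
    using sum_list_runners[OF t q, of K] K(1) by (simp add: s_def)
  have sm: "real (sum_list \<mu>) = (\<Sum>r\<in>?R. m r * \<rho> r + real t * m r * (m r - 1) / 2) + real K * (real K + 1) / 2"
    using sum_list_runners[OF t \<mu> K(2)] runner_core[OF t \<mu> core] card
    by (simp add: m_def \<rho>_def)
  have mK: "(\<Sum>r\<in>?R. m r) = real K"
    using sum_card_runners[OF t q, of K] K(1) by (simp add: m_def)
  have "(\<Sum>r\<in>?R. \<Sum>x \<in> runner t K q r. w r x * (?h x / real t)) =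
      (\<Sum>r\<in>?R. content_energy q / real t + real t * s r + real t * (m r * \<rho> r + real t * m r * (m r - 1) / 2)
        + \<rho> r ^ 2 + (1 - real t) * \<rho> r + real t * m r - real t + c)"
  proof (rule sum.cong[OF refl])
    fix r assume r: "r \<in> ?R"
    show "(\<Sum>x \<in> runner t K q r. w r x * (?h x / real t)) =
      content_energy q / real t + real t * s r + real t * (m r * \<rho> r + real t * m r * (m r - 1) / 2)
        + \<rho> r ^ 2 + (1 - real t) * \<rho> r + real t * m r - real t + c"
      unfolding inner[OF r] by (simp add: u_def \<rho>_def[symmetric] power2_eq_square field_simps)
  qed
  also have "\<dots> = content_energy q + real t * (real (sum_list q) + real (sum_list \<mu>)) + (real t ^ 3 - real t) / 6"
  proof -
    define S where "S = (\<Sum>r\<in>?R. s r)"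
    define M where "M = (\<Sum>r\<in>?R. m r * \<rho> r + real t * m r * (m r - 1) / 2)"
    have "(\<Sum>r\<in>?R. content_energy q / real t + real t * s r + real t * (m r * \<rho> r + real t * m r * (m r - 1) / 2)
        + \<rho> r ^ 2 + (1 - real t) * \<rho> r + real t * m r - real t + c) =
      real t * (content_energy q / real t) + real t * S + real t * M + (\<Sum>r\<in>?R. \<rho> r ^ 2)
        + (1 - real t) * (\<Sum>r\<in>?R. \<rho> r) + real t * (\<Sum>r\<in>?R. m r)
        - real t * real t + real t * c"
      by (simp only: S_def M_def sum.distrib sum_subtractf sum_distrib_left[symmetric] sum_constant cardR)
    \<comment> \<open>The two size formulas contribute - t K (K + 1), which cancels against the
      residue sums and the term t K. The remaining constants combine to (t^3 - t) / 6.\<close>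
    also have "\<dots> = content_energy q + real t * (real (sum_list q) + real (sum_list \<mu>)) + (real t ^ 3 - real t) / 6"
      unfolding sq sm mK S_def[symmetric] M_def[symmetric] unfolding \<rho>_def sum_residues c_def
      using t by (simp add: power2_eq_square power3_eq_cube field_simps)
    finally show ?thesis .
  qed
  finally have main: "(\<Sum>r\<in>?R. \<Sum>x \<in> runner t K q r. w r x * (?h x / real t)) = \<dots>" .
  have "(\<Sum>p | adds_hook t q p. G t p * content_energy p) =
      G t q * (\<Sum>r\<in>?R. \<Sum>x \<in> runner t K q r. w r x * (?h x / real t))"
    unfolding w_def c_def by (rule sum_adds_hook[OF t q K(1) content_energy_move])
  then show ?thesis unfolding main .
qed

section \<open>Chains of added hooks and the recursion for \<open>F\<close>\<close>

lemma hook_ge_partition: "hook_ge t p q \<Longrightarrow> is_partition q \<Longrightarrow> is_partition p"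
  unfolding hook_ge_def by (induction rule: rtranclp_induct) (auto simp: adds_hook_def)

lemma adds_hook_sum_list: "t > 0 \<Longrightarrow> adds_hook t q p \<Longrightarrow> sum_list p = sum_list q + t"
  using hook_move.sum_list_move by (auto simp: adds_hook_iff_hook_move)

lemma hook_ge_sum_list:
  assumes t: "t > 0" and "hook_ge t p q"
  shows "p = q \<or> sum_list q + t \<le> sum_list p"
  using assms(2) unfolding hook_ge_def
  by (induction rule: rtranclp_induct) (auto dest: adds_hook_sum_list[OF t])

text \<open>Each step adds \<open>t\<close> boxes, so a chain that gains exactly \<open>t\<close>
  boxes is a single step. This turns the size condition in the recursion for \<open>F\<close> into
  \<open>adds_hook\<close>.\<close>

lemma hook_ge_adds_hook:
  assumes t: "t > 0" and ge: "hook_ge t p q" and sum: "sum_list p = sum_list q + t"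
  shows "adds_hook t q p"
  using ge[unfolded hook_ge_def]
proof (cases rule: rtranclp.cases)
  case rtrancl_refl then show ?thesis using sum t by simp
next
  case (rtrancl_into_rtrancl p')
  then have "p' = q"
    using hook_ge_sum_list[OF t, of p' q] adds_hook_sum_list[OF t, of p' p] sum t
    by (auto simp: hook_ge_def)
  then show ?thesis using rtrancl_into_rtrancl by simp
qed

text \<open>Sizes grow along the chain, so the bound on \<open>sum_list p\<close> passes to all
  intermediate partitions and bounds their lengths, as each move requires.\<close>

lemma card_runner_hook_ge:
  assumes t: "t > 0" and "hook_ge t p q" "sum_list p + t \<le> K"
  shows "card (runner t K p r) = card (runner t K q r)"
  using assms(2,3) unfolding hook_ge_def
proof (induction rule: rtranclp_induct)
  case (step p' p)
  obtain x where "hook_move t p' p x" using step.hyps t adds_hook_iff_hook_move by blast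
  then interpret hook_move t p' p x .
  show ?case
    using step card_runner_move[of K r] sum_list_move length_le_sum_list[OF q] by simp
qed simp

lemma F_rec:
  assumes t: "t > 0" and q: "is_partition q" and ne: "p \<noteq> q"
  shows "F t p q = (\<Sum>p' | adds_hook t p' p \<and> hook_ge t p' q. F t p' q)"
proof -
  have "{p'. hook_ge t p p' \<and> hook_ge t p' q \<and> sum_list p = sum_list p' + t} =
      {p'. adds_hook t p' p \<and> hook_ge t p' q}"
    using hook_ge_adds_hook[OF t] adds_hook_sum_list[OF t] by (auto simp: hook_ge_def)
  then show ?thesis using t ne by (subst F.simps) simp
qed

definition core_level :: "nat \<Rightarrow> nat list \<Rightarrow> nat \<Rightarrow> nat list set" where
  "core_level t \<mu> n = {p. hook_ge t p \<mu> \<and> sum_list p = sum_list \<mu> + n * t}"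

lemma finite_core_level: "is_partition \<mu> \<Longrightarrow> finite (core_level t \<mu> n)"
  unfolding core_level_def
  by (rule finite_subset[OF _ finite_partitions[of "sum_list \<mu> + n * t"]]) (auto dest: hook_ge_partition)

lemma core_level_0: "t > 0 \<Longrightarrow> core_level t \<mu> 0 = {\<mu>}"
  using hook_ge_sum_list[of t _ \<mu>] by (fastforce simp: core_level_def hook_ge_def)

text \<open>Double counting of the added hooks that lead from level \<open>n\<close> to level
  \<open>n + 1\<close>: \<open>F\<close> groups them by the larger partition, the right-hand side by
  the smaller one.\<close>

lemma sum_core_level_Suc:
  assumes t: "t > 0" and \<mu>: "is_partition \<mu>"
  shows "(\<Sum>p \<in> core_level t \<mu> (Suc n). real (F t p \<mu>) * f p) =
    (\<Sum>q \<in> core_level t \<mu> n. real (F t q \<mu>) * (\<Sum>p | adds_hook t q p. f p))"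
proof -
  let ?L = "core_level t \<mu>"
  have "(\<Sum>p \<in> ?L (Suc n). real (F t p \<mu>) * f p) =
      (\<Sum>p \<in> ?L (Suc n). \<Sum>q \<in> {q \<in> ?L n. adds_hook t q p}. real (F t q \<mu>) * f p)"
  proof (rule sum.cong[OF refl])
    fix p assume p: "p \<in> ?L (Suc n)"
    then have "p \<noteq> \<mu>" using t by (auto simp: core_level_def)
    moreover have "{q. adds_hook t q p \<and> hook_ge t q \<mu>} = {q \<in> ?L n. adds_hook t q p}"
      using p adds_hook_sum_list[OF t] by (fastforce simp: core_level_def)
    ultimately show "real (F t p \<mu>) * f p = (\<Sum>q \<in> {q \<in> ?L n. adds_hook t q p}. real (F t q \<mu>) * f p)"
      by (simp add: F_rec[OF t \<mu>] sum_distrib_right)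
  qed
  also have "\<dots> = (\<Sum>q \<in> ?L n. \<Sum>p \<in> {p \<in> ?L (Suc n). adds_hook t q p}. real (F t q \<mu>) * f p)"
    by (rule sum.swap_restrict) (simp_all add: finite_core_level \<mu>)
  also have "\<dots> = (\<Sum>q \<in> ?L n. real (F t q \<mu>) * (\<Sum>p | adds_hook t q p. f p))"
  proof (rule sum.cong[OF refl])
    fix q assume q: "q \<in> ?L n"
    \<comment> \<open>Anything obtained from \<open>q\<close> by adding a hook lies in the next
      level, so the inner sum is unrestricted.\<close>
    have "p \<in> ?L (Suc n)" if "adds_hook t q p" for p
      using q that adds_hook_sum_list[OF t that]
      by (auto simp: core_level_def hook_ge_def intro: rtranclp.rtrancl_into_rtrancl)
    then have "{p \<in> ?L (Suc n). adds_hook t q p} = {p. adds_hook t q p}" by blast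
    then show "(\<Sum>p \<in> {p \<in> ?L (Suc n). adds_hook t q p}. real (F t q \<mu>) * f p) =
        real (F t q \<mu>) * (\<Sum>p | adds_hook t q p. f p)"
      by (simp add: sum_distrib_left)
  qed
  finally show ?thesis .
qed

lemma no_adds_hook_core:
  assumes "t > 0" "hook_pairs t \<mu> = {}" shows "\<not> adds_hook t q \<mu>"
proof
  assume "adds_hook t q \<mu>"
  then obtain x where "hook_move t q \<mu> x" using adds_hook_iff_hook_move assms(1) by blast
  then have "(x, x + int t) \<in> hook_pairs t \<mu>" by (auto simp: hook_move_def hook_pairs_def)
  then show False using assms(2) by simp
qed

lemma G_core: "is_partition \<mu> \<Longrightarrow> hook_pairs t \<mu> = {} \<Longrightarrow> G t \<mu> = 1"
  by (simp add: G_hook_pairs)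

text \<open>With transition probabilities \<open>G t p / G t q\<close>, adding hooks is a Markov
  chain started at \<open>\<mu>\<close>; the weights \<open>F * G\<close> are its distribution after
  \<open>n\<close> steps.\<close>

lemma sum_F_G:
  assumes t: "t > 0" and \<mu>: "is_partition \<mu>" and core: "hook_pairs t \<mu> = {}"
  shows "(\<Sum>p \<in> core_level t \<mu> n. real (F t p \<mu>) * G t p) = 1"
proof (induction n)
  case 0
  then show ?case using G_core[OF \<mu> core] by (simp add: core_level_0 t F.simps[of t \<mu> \<mu>])
next
  case (Suc n)
  have "(\<Sum>p | adds_hook t q p. G t p) = G t q" if "q \<in> core_level t \<mu> n" for q
    using that sum_G_adds_hook[OF t] hook_ge_partition \<mu> by (auto simp: core_level_def)
  then show ?case using Suc by (simp add: sum_core_level_Suc[OF t \<mu>])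
qed

lemma sum_F_G_content_energy:
  assumes t: "t > 0" and \<mu>: "is_partition \<mu>" and core: "hook_pairs t \<mu> = {}"
  shows "(\<Sum>p \<in> core_level t \<mu> n. real (F t p \<mu>) * (G t p * content_energy p)) =
    (real t)\<^sup>2 * real (n choose 2) + ((real t) ^ 3 - real t) * real n / 6
         + 2 * real t * real n * real (sum_list \<mu>) + content_energy \<mu>"
proof (induction n)
  case 0
  then show ?case using G_core[OF \<mu> core] by (simp add: core_level_0 t F.simps[of t \<mu> \<mu>])
next
  case (Suc n)
  let ?L = "core_level t \<mu> n"
  \<comment> \<open>On level \<open>n\<close> the two sizes add up to 2 |\<mu>| + n t, so the
    increment is the same for every \<open>q\<close> there.\<close>
  define d where "d = real t * (2 * real (sum_list \<mu>) + real n * real t) + (real t ^ 3 - real t) / 6"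
  have "(\<Sum>p | adds_hook t q p. G t p * content_energy p) = G t q * content_energy q + d * G t q"
    if q: "q \<in> ?L" for q
  proof -
    have ge: "hook_ge t q \<mu>" and sum: "sum_list q = sum_list \<mu> + n * t" using q by (auto simp: core_level_def)
    have qp: "is_partition q" using hook_ge_partition[OF ge \<mu>] .
    \<comment> \<open>The choice \<open>K = sum_list q + 2 * t\<close> exceeds both lengths by
      enough and also meets the bound needed for equal runner counts.\<close>
    have "(\<Sum>p | adds_hook t q p. G t p * content_energy p) =
      G t q * (content_energy q + real t * (real (sum_list q) + real (sum_list \<mu>)) + (real t ^ 3 - real t) / 6)"
      using length_le_sum_list[OF qp] length_le_sum_list[OF \<mu>] sum card_runner_hook_ge[OF t ge]
      by (intro sum_G_content_energy_adds_hook[OF t qp \<mu> core, where K = "sum_list q + 2 * t"]) auto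
    then show ?thesis by (simp add: sum d_def algebra_simps)
  qed
  then have "(\<Sum>p \<in> core_level t \<mu> (Suc n). real (F t p \<mu>) * (G t p * content_energy p)) =
      (\<Sum>q \<in> ?L. real (F t q \<mu>) * (G t q * content_energy q) + d * (real (F t q \<mu>) * G t q))"
    unfolding sum_core_level_Suc[OF t \<mu>] by (intro sum.cong) (auto simp: algebra_simps)
  also have "\<dots> = (\<Sum>q \<in> ?L. real (F t q \<mu>) * (G t q * content_energy q)) + d"
    by (simp add: sum.distrib sum_distrib_left[symmetric] sum_F_G[OF assms])
  also have "\<dots> = (real t)\<^sup>2 * real (Suc n choose 2) + ((real t) ^ 3 - real t) * real (Suc n) / 6
         + 2 * real t * real (Suc n) * real (sum_list \<mu>) + content_energy \<mu>"
    unfolding Suc.IH d_def by (simp add: numeral_2_eq_2 power2_eq_square field_simps)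
  finally show ?case .
qed

theorem theorem6p4:
  fixes t n :: nat and \<mu> :: "nat list"
  assumes "t > 0" and "t_core t \<mu>"
  shows "(\<Sum>p \<in> {p. is_partition p \<and> is_t_core_of t \<mu> p \<and> sum_list p = sum_list \<mu> + n * t}.
            real (F t p \<mu>) * G t p * (\<Sum>b \<in> diagram p. (real_of_int (content b))\<^sup>2))
       = (real t)\<^sup>2 * real (n choose 2) + ((real t) ^ 3 - real t) * real n / 6
         + 2 * real t * real n * real (sum_list \<mu>)
         + (\<Sum>b \<in> diagram \<mu>. (real_of_int (content b))\<^sup>2)"
proof -
  have \<mu>: "is_partition \<mu>" using assms(2) by (simp add: t_core_def)
  have core: "hook_pairs t \<mu> = {}" using assms(2) t_core_iff[OF \<mu>] by blast
  \<comment> \<open>No hook can be removed from \<open>\<mu>\<close>, so having \<open>\<mu>\<close>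
    as core means just being reachable from it.\<close>
  have "{p. is_partition p \<and> is_t_core_of t \<mu> p \<and> sum_list p = sum_list \<mu> + n * t} = core_level t \<mu> n"
    using no_adds_hook_core[OF assms(1) core] hook_ge_partition[OF _ \<mu>]
    by (auto simp: core_level_def is_t_core_of_def)
  then show ?thesis
    using sum_F_G_content_energy[OF assms(1) \<mu> core, of n]
    by (simp add: content_energy_def mult.assoc)
qed

end
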